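(* Let $\mu\in\mathbb{R}^n$, let $K$ be a closed convex subset of $\mathbb{R}^n$, let $u\in K$, and let $\mathcal{T}_{K,u}$ be the tangent cone of $K$ at $u$. Let $\sigma>0$, $\xi\sim\mathcal{N}(0,\sigma^2 I_{n\times n})$, $y=\mu+\xi$ and $\hat\mu=\hat\mu^{LS}(K)$. Then $$\mathbb{E}\left[\|\hat\mu-\mu\|^2\right]\le \|u-\mu\|^2+\frac{\sigma^2}{n}\,\delta(\mathcal{T}_{K,u}).$$ Furthermore, for all $x>0$, with probability at least $1-e^{-x}$, $$\|\hat\mu-\mu\|^2-\|u-\mu\|^2\le \frac{\sigma^2}{n}\left(\delta(\mathcal{T}_{K,u})^{1/2}+\sqrt{2x}\right)^2\le\frac{\sigma^2}{n}\left(2\,\delta(\mathcal{T}_{K,u})+4x\right).$$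
   Context: Scaled norm: $\|v\|^2=\frac1n\sum_{i=1}^n v_i^2$ for $v\in\mathbb{R}^n$; $|\cdot|_2$ is the Euclidean norm. The least squares estimator over a nonempty closed set $K$ is $\hat\mu^{LS}(K)\in\operatorname{argmin}_{v\in K}\|y-v\|^2$ (for $K$ closed convex, it is the projection $\Pi_K(y)$). Tangent cone: $\mathcal{T}_{K,u}=\mathrm{closure}\{t(v-u): t\ge0,\ v\in K\}$. Statistical dimension of a closed convex cone $L\subset\mathbb{R}^n$: $\delta(L)=\mathbb{E}\left[|\Pi_L(g)|_2^2\right]$, where $g\sim\mathcal{N}(0,I_{n\times n})$ and $\Pi_L$ is the Euclidean projection onto $L$. *)

theory Defs
  imports "HOL-Probability.Probability"
begin

definition scaled_norm :: "real ^ 'n \<Rightarrow> real" where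
  "scaled_norm v = sqrt (1 / real CARD('n) * (\<Sum>i\<in>UNIV. (v $ i)\<^sup>2))"

(* Minimisers over K need not exist or be unique for general K, so the estimator is a relation. *)
definition is_least_squares :: "(real ^ 'n) set \<Rightarrow> real ^ 'n \<Rightarrow> real ^ 'n \<Rightarrow> bool" where
  "is_least_squares K y m \<longleftrightarrow> is_arg_min (\<lambda>v. (scaled_norm (y - v))\<^sup>2) (\<lambda>v. v \<in> K) m"

definition tangent_cone :: "(real ^ 'n) set \<Rightarrow> real ^ 'n \<Rightarrow> (real ^ 'n) set" where
  "tangent_cone K u = closure {t *\<^sub>R (v - u) | t v. t \<ge> 0 \<and> v \<in> K}"

(* Lebesgue density of N(0, s^2 I); s is the standard deviation of each coordinate. *)
definition isotropic_normal_density :: "real \<Rightarrow> real ^ 'n \<Rightarrow> real" where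
  "isotropic_normal_density s x = (\<Prod>i\<in>UNIV. normal_density 0 s (x $ i))"

(* The integrand is dominated by the squared norm of g when L is a closed convex cone,
   so the Bochner integral is then a genuine (finite) expectation. *)
definition statistical_dimension :: "(real ^ 'n) set \<Rightarrow> real" where
  "statistical_dimension L =
     (\<integral>g. (norm (closest_point L g))\<^sup>2
        \<partial>(density lborel (\<lambda>x. ennreal (isotropic_normal_density 1 x))))"

end

theory Submission
  imports Defs
begin

text \<open>
  Write \<open>T\<close> for the tangent cone and \<open>p\<close> for the projection onto it. The variational inequality
  for the projection onto \<open>K\<close> bounds the excess risk, in Euclidean norm, by
  \<open>2 * (\<xi> \<bullet> d) - (norm d)\<^sup>2\<close> with \<open>d = \<mu>hat - u\<close> in \<open>T\<close>, and this is at most \<open>(norm (p \<xi>))\<^sup>2\<close>.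
  Taking expectations gives the first bound. The second one is Gaussian concentration, with the
  sharp constant, of \<open>norm \<circ> p\<close> around \<open>sqrt \<delta>\<close>.

  For concentration, let \<open>F\<close> be 1-Lipschitz with a second-order remainder bounded by
  \<open>C * (norm h)\<^sup>2\<close>, a class preserved by Gaussian averaging. A Gaussian step of
  standard deviation \<open>s\<close> satisfies \<open>E exp (l * (F - E F)) \<le> exp (l\<^sup>2 * s\<^sup>2 / 2 + K * s ^ 3)\<close>.
  A standard Gaussian is a sum of \<open>N\<close> independent steps with \<open>s = 1 / sqrt N\<close>, so conditioning
  step by step and letting \<open>N\<close> tend to infinity yields the bound \<open>exp (l\<^sup>2 / 2)\<close>. This is applied
  to \<open>sqrt (e\<^sup>2 + (norm (p x))\<^sup>2)\<close>, whose mean is at most \<open>sqrt (e\<^sup>2 + \<delta>)\<close>, and \<open>e\<close> tends to \<open>0\<close>.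
\<close>

subsection \<open>Isotropic normal measures\<close>

definition isotropic_normal :: "real \<Rightarrow> (real ^ 'n) measure" where
  "isotropic_normal s = density lborel (\<lambda>x. ennreal (isotropic_normal_density s x))"

lemma isotropic_normal_density_nonneg [simp]: "0 \<le> isotropic_normal_density s x"
  by (simp add: isotropic_normal_density_def prod_nonneg)

lemma borel_measurable_isotropic_normal_density [measurable]:
  "isotropic_normal_density s \<in> borel_measurable borel"
  unfolding isotropic_normal_density_def[abs_def] by measurable

lemma sets_isotropic_normal [simp, measurable_cong]: "sets (isotropic_normal s) = sets borel"
  and space_isotropic_normal [simp]: "space (isotropic_normal s) = UNIV"
  by (simp_all add: isotropic_normal_def)

lemma norm_vec_square: "(norm (x :: real ^ 'n))\<^sup>2 = (\<Sum>i\<in>UNIV. (x $ i)\<^sup>2)"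
  by (simp add: power2_norm_eq_inner inner_vec_def) (simp add: power2_eq_square)

lemma isotropic_normal_density_eq_exp:
  fixes x :: "real ^ 'n"
  assumes "s > 0"
  shows "isotropic_normal_density s x =
    (1 / sqrt (2 * pi * s\<^sup>2)) ^ CARD('n) * exp (- (norm x)\<^sup>2 / (2 * s\<^sup>2))"
proof -
  have "isotropic_normal_density s x =
      (1 / sqrt (2 * pi * s\<^sup>2)) ^ CARD('n) * (\<Prod>i\<in>UNIV. exp (- (x $ i)\<^sup>2 / (2 * s\<^sup>2)))"
    unfolding isotropic_normal_density_def normal_density_def
    by (simp only: prod.distrib prod_constant diff_zero)
  also have "(\<Prod>i\<in>UNIV. exp (- (x $ i)\<^sup>2 / (2 * s\<^sup>2))) = exp (- (norm x)\<^sup>2 / (2 * s\<^sup>2))"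
    by (simp add: exp_sum[symmetric] sum_divide_distrib[symmetric] sum_negf norm_vec_square)
  finally show ?thesis .
qed

lemma nn_integral_isotropic_normal_density:
  assumes "s > 0"
  shows "(\<integral>\<^sup>+(x::real ^ 'n). ennreal (isotropic_normal_density s x) \<partial>lborel) = 1"
proof -
  have "(\<integral>\<^sup>+(x::real ^ 'n). ennreal (isotropic_normal_density s x) \<partial>lborel) =
      (\<integral>\<^sup>+(x::real ^ 'n). (\<Prod>b\<in>Basis. ennreal (normal_density 0 s (x \<bullet> b))) \<partial>lborel)"
  proof (intro nn_integral_cong)
    fix x :: "real ^ 'n"
    \<comment> \<open>The product formula for \<open>lborel\<close> runs over \<open>Basis\<close>,
      the density over coordinates; the basis vectors are the \<open>axis i 1\<close>, so the two
      products are matched by reindexing.\<close>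
    have "(\<Prod>b\<in>Basis. normal_density 0 s (x \<bullet> b)) = (\<Prod>i\<in>UNIV. normal_density 0 s (x $ i))"
      by (rule prod.reindex_bij_witness[where i="\<lambda>i. axis i 1" and j=axis_index])
        (auto simp: Basis_vec_def axis_index_axis inner_axis)
    then show "ennreal (isotropic_normal_density s x) =
        (\<Prod>b\<in>Basis. ennreal (normal_density 0 s (x \<bullet> b)))"
      by (simp add: isotropic_normal_density_def prod_ennreal)
  qed
  also have "\<dots> = (\<Prod>b\<in>(Basis :: (real ^ 'n) set). \<integral>\<^sup>+x. ennreal (normal_density 0 s x) \<partial>lborel)"
    by (rule nn_integral_lborel_prod) auto
  also have "(\<integral>\<^sup>+x. ennreal (normal_density 0 s x) \<partial>lborel) = 1"
    using assms by (simp add: nn_integral_eq_integral)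
  finally show ?thesis by simp
qed

lemma prob_space_isotropic_normal: "s > 0 \<Longrightarrow> prob_space (isotropic_normal s)"
  by (rule prob_spaceI)
    (simp add: isotropic_normal_def emeasure_density nn_integral_isotropic_normal_density)

lemma nn_integral_isotropic_normal:
  assumes [measurable]: "f \<in> borel_measurable borel"
  shows "(\<integral>\<^sup>+x. f x \<partial>isotropic_normal s) =
    (\<integral>\<^sup>+x. ennreal (isotropic_normal_density s x) * f x \<partial>lborel)"
  unfolding isotropic_normal_def by (rule nn_integral_density) auto

section \<open>Translation, scaling and convolution\<close>

lemma nn_integral_lborel_translate:
  fixes a :: "'a::euclidean_space"
  assumes [measurable]: "f \<in> borel_measurable borel"
  shows "(\<integral>\<^sup>+x. f (a + x) \<partial>lborel) = (\<integral>\<^sup>+x. f x \<partial>lborel)"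
proof -
  have "(\<integral>\<^sup>+x. f x \<partial>lborel) = (\<integral>\<^sup>+x. f x \<partial>distr lborel borel ((+) a))"
    by (simp add: lborel_distr_plus)
  also have "\<dots> = (\<integral>\<^sup>+x. f (a + x) \<partial>lborel)"
    by (rule nn_integral_distr) auto
  finally show ?thesis ..
qed

text \<open>Besides changes of standard deviation, this has to cover the reflection
  \<open>c = - 1\<close>, which is why the sign of \<open>c\<close> is left free and
  \<open>\<bar>c\<bar>\<close> appears in the result.\<close>

lemma distr_isotropic_normal_scaleR:
  assumes "s > 0" "c \<noteq> 0"
  shows "distr (isotropic_normal s) borel (\<lambda>x::real ^ 'n. c *\<^sub>R x) = isotropic_normal (\<bar>c\<bar> * s)"
proof (rule measure_eqI)
  fix A :: "(real ^ 'n) set"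
  assume "A \<in> sets (distr (isotropic_normal s) borel (\<lambda>x. c *\<^sub>R x))"
  then have [measurable]: "A \<in> sets borel" by simp
  \<comment> \<open>The factor \<open>\<bar>c\<bar> ^ CARD('n)\<close> is the Jacobian of the
    scaling, which \<open>lborel_affine\<close> produces again when the variable is changed
    back.\<close>
  have dens: "isotropic_normal_density s x =
      \<bar>c\<bar> ^ CARD('n) * isotropic_normal_density (\<bar>c\<bar> * s) (c *\<^sub>R x)" for x :: "real ^ 'n"
  proof -
    have 1: "(norm (c *\<^sub>R x))\<^sup>2 / (2 * (\<bar>c\<bar> * s)\<^sup>2) = (norm x)\<^sup>2 / (2 * s\<^sup>2)"
      using assms by (simp add: power_mult_distrib)
    have 2: "\<bar>c\<bar> * (1 / sqrt (2 * pi * (\<bar>c\<bar> * s)\<^sup>2)) = 1 / sqrt (2 * pi * s\<^sup>2)"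
      using assms by (simp add: real_sqrt_mult)
    have "\<bar>c\<bar> ^ CARD('n) * (1 / sqrt (2 * pi * (\<bar>c\<bar> * s)\<^sup>2)) ^ CARD('n) =
        (1 / sqrt (2 * pi * s\<^sup>2)) ^ CARD('n)"
      by (simp only: 2 power_mult_distrib[symmetric])
    then show ?thesis
      using assms 1 by (simp add: isotropic_normal_density_eq_exp)
  qed
  have "emeasure (distr (isotropic_normal s) borel (\<lambda>x. c *\<^sub>R x)) A =
      (\<integral>\<^sup>+x. indicator A x \<partial>distr (isotropic_normal s) borel (\<lambda>x. c *\<^sub>R x))"
    by simp
  also have "\<dots> = (\<integral>\<^sup>+x. indicator A (c *\<^sub>R x) \<partial>isotropic_normal s)"
    by (rule nn_integral_distr) auto
  also have "\<dots> = (\<integral>\<^sup>+x. ennreal (isotropic_normal_density s x) * indicator A (c *\<^sub>R x) \<partial>lborel)"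
    by (rule nn_integral_isotropic_normal) auto
  also have "\<dots> = (\<integral>\<^sup>+x. ennreal (\<bar>c\<bar> ^ CARD('n)) *
      (ennreal (isotropic_normal_density (\<bar>c\<bar> * s) (c *\<^sub>R x)) * indicator A (c *\<^sub>R x)) \<partial>lborel)"
    by (subst dens) (simp add: ennreal_mult mult.assoc)
  also have "\<dots> = (\<integral>\<^sup>+x. ennreal (isotropic_normal_density (\<bar>c\<bar> * s) x) * indicator A x \<partial>lborel)"
    by (subst (2) lborel_affine[of c 0])
      (use assms in \<open>simp_all add: nn_integral_density nn_integral_distr ennreal_power[symmetric]\<close>)
  also have "\<dots> = (\<integral>\<^sup>+x. indicator A x \<partial>isotropic_normal (\<bar>c\<bar> * s))"
    by (rule nn_integral_isotropic_normal[symmetric]) auto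
  finally show "emeasure (distr (isotropic_normal s) borel (\<lambda>x. c *\<^sub>R x)) A =
      emeasure (isotropic_normal (\<bar>c\<bar> * s)) A"
    by simp
qed simp

text \<open>For independent centred normals Y and Z with standard deviations \<open>a\<close> and
  \<open>b\<close>, the left side is the joint density of the sum W = Y + Z and of Z. The right side
  factors it as the density of W times the conditional density of Z given W, with conditional mean
  \<open>b\<^sup>2 / (a\<^sup>2 + b\<^sup>2) * w\<close>.\<close>

lemma normal_density_mult_complete_square:
  fixes a b w z :: real
  assumes "a > 0" "b > 0"
  shows "normal_density 0 a (w - z) * normal_density 0 b z =
    normal_density 0 (sqrt (a\<^sup>2 + b\<^sup>2)) w *
      normal_density 0 (a * b / sqrt (a\<^sup>2 + b\<^sup>2)) (z - b\<^sup>2 / (a\<^sup>2 + b\<^sup>2) * w)"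
proof -
  define q where "q = a\<^sup>2 + b\<^sup>2"
  have q: "q > 0" using assms by (simp add: q_def add_pos_pos)
  have e: "(w - z)\<^sup>2 / (2 * a\<^sup>2) + z\<^sup>2 / (2 * b\<^sup>2) =
      w\<^sup>2 / (2 * q) + (z - b\<^sup>2 / q * w)\<^sup>2 / (2 * (a\<^sup>2 * b\<^sup>2 / q))"
  proof -
    define A where "A = a\<^sup>2"
    define B where "B = b\<^sup>2"
    have AB: "A > 0" "B > 0" "q = A + B" using assms by (simp_all add: A_def B_def q_def)
    have "(w - z)\<^sup>2 / (2 * A) + z\<^sup>2 / (2 * B) = ((w - z)\<^sup>2 * B + z\<^sup>2 * A) * q / (2 * A * B * q)"
      using AB(1,2) q by (simp add: field_simps)
    also have "((w - z)\<^sup>2 * B + z\<^sup>2 * A) * q = w\<^sup>2 * (A * B) + (q * z - B * w)\<^sup>2"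
      unfolding AB(3) by algebra
    also have "(q * z - B * w)\<^sup>2 = q\<^sup>2 * (z - B / q * w)\<^sup>2"
      using q by (simp add: power_mult_distrib[symmetric] right_diff_distrib)
    also have "(w\<^sup>2 * (A * B) + q\<^sup>2 * (z - B / q * w)\<^sup>2) / (2 * A * B * q) =
        w\<^sup>2 / (2 * q) + (z - B / q * w)\<^sup>2 / (2 * (A * B / q))"
      using AB(1,2) q by (simp add: add_divide_distrib power2_eq_square)
    finally show ?thesis by (simp add: A_def B_def)
  qed
  have p: "sqrt (2 * pi * a\<^sup>2) * sqrt (2 * pi * b\<^sup>2) =
      sqrt (2 * pi * q) * sqrt (2 * pi * (a\<^sup>2 * b\<^sup>2 / q))"
    using q by (simp add: real_sqrt_mult[symmetric])
  \<comment> \<open>Read from right to left, this merges two Gaussian factors into one constant and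
    one exponential, on which \<open>p\<close> and \<open>e\<close> act separately.\<close>
  have split: "1 / (P * Q) * exp (- (X / U + Y / V)) = (1 / P * exp (- X / U)) * (1 / Q * exp (- Y / V))"
    for P Q X Y U V :: real
    by (simp add: exp_diff exp_minus field_simps)
  have "(a * b / sqrt q)\<^sup>2 = a\<^sup>2 * b\<^sup>2 / q" "(sqrt q)\<^sup>2 = q"
    using q by (simp_all add: power_mult_distrib power_divide)
  then have "normal_density 0 a (w - z) * normal_density 0 b z =
      normal_density 0 (sqrt q) w * normal_density 0 (a * b / sqrt q) (z - b\<^sup>2 / q * w)"
    by (simp only: normal_density_def diff_zero split[symmetric] e p)
  then show ?thesis by (simp only: q_def)
qed

text \<open>Substituting w = y + z and swapping the integrals brings the integrand into the factored
  form of the preceding lemma, coordinate by coordinate. The conditional density then integrates to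
  1 in z and the density of the sum remains.\<close>

lemma convolution_isotropic_normal:
  assumes "a > 0" "b > 0"
  shows "isotropic_normal a \<star> isotropic_normal b =
    (isotropic_normal (sqrt (a\<^sup>2 + b\<^sup>2)) :: (real ^ 'n) measure)"
proof (rule measure_eqI)
  fix A :: "(real ^ 'n) set"
  assume "A \<in> sets (isotropic_normal a \<star> isotropic_normal b)"
  then have [measurable]: "A \<in> sets borel" by simp
  interpret A: prob_space "isotropic_normal a :: (real ^ 'n) measure"
    by (rule prob_space_isotropic_normal[OF assms(1)])
  interpret B: prob_space "isotropic_normal b :: (real ^ 'n) measure"
    by (rule prob_space_isotropic_normal[OF assms(2)])
  let ?\<gamma> = "\<lambda>s x::real ^ 'n. ennreal (isotropic_normal_density s x)"
  define c where "c = sqrt (a\<^sup>2 + b\<^sup>2)"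
  define d where "d = a * b / c"
  define k where "k = b\<^sup>2 / (a\<^sup>2 + b\<^sup>2)"
  have c: "c > 0" and d: "d > 0"
    using assms by (simp_all add: c_def d_def add_pos_pos)
  have dens: "?\<gamma> a (w - z) * ?\<gamma> b z = ?\<gamma> c w * ?\<gamma> d (- (k *\<^sub>R w) + z)" for w z
    unfolding isotropic_normal_density_def c_def d_def k_def
    using normal_density_mult_complete_square[OF assms]
    by (simp add: ennreal_mult[symmetric] prod_nonneg prod.distrib[symmetric])
  have "emeasure (isotropic_normal a \<star> isotropic_normal b) A =
      (\<integral>\<^sup>+x. indicator A x \<partial>(isotropic_normal a \<star> isotropic_normal b))"
    by simp
  also have "\<dots> = (\<integral>\<^sup>+y. \<integral>\<^sup>+z. indicator A (y + z) \<partial>isotropic_normal b \<partial>isotropic_normal a)"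
    by (rule nn_integral_convolution) (auto intro: A.finite_measure_axioms B.finite_measure_axioms)
  also have "\<dots> = (\<integral>\<^sup>+y. ?\<gamma> a y * (\<integral>\<^sup>+z. ?\<gamma> b z * indicator A (y + z) \<partial>lborel) \<partial>lborel)"
    by (simp add: nn_integral_isotropic_normal)
  also have "\<dots> = (\<integral>\<^sup>+y. \<integral>\<^sup>+z. ?\<gamma> a y * ?\<gamma> b z * indicator A (y + z) \<partial>lborel \<partial>lborel)"
    by (simp add: nn_integral_cmult[symmetric] mult.assoc)
  also have "\<dots> = (\<integral>\<^sup>+z. \<integral>\<^sup>+y. ?\<gamma> a y * ?\<gamma> b z * indicator A (y + z) \<partial>lborel \<partial>lborel)"
    by (rule lborel_pair.Fubini'[symmetric]) measurable
  also have "\<dots> = (\<integral>\<^sup>+z. \<integral>\<^sup>+w. ?\<gamma> a (w - z) * ?\<gamma> b z * indicator A w \<partial>lborel \<partial>lborel)"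
  proof (rule nn_integral_cong)
    fix z
    show "(\<integral>\<^sup>+y. ?\<gamma> a y * ?\<gamma> b z * indicator A (y + z) \<partial>lborel) =
        (\<integral>\<^sup>+w. ?\<gamma> a (w - z) * ?\<gamma> b z * indicator A w \<partial>lborel)"
      by (subst nn_integral_lborel_translate[where a=z, symmetric]) (auto simp: add.commute)
  qed
  also have "\<dots> = (\<integral>\<^sup>+w. \<integral>\<^sup>+z. ?\<gamma> a (w - z) * ?\<gamma> b z * indicator A w \<partial>lborel \<partial>lborel)"
    by (rule lborel_pair.Fubini'[symmetric]) measurable
  also have "\<dots> = (\<integral>\<^sup>+w. ?\<gamma> c w * indicator A w * (\<integral>\<^sup>+z. ?\<gamma> d (- (k *\<^sub>R w) + z) \<partial>lborel) \<partial>lborel)"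
    by (simp only: dens) (simp add: nn_integral_cmult[symmetric] mult_ac)
  also have "\<dots> = (\<integral>\<^sup>+w. ?\<gamma> c w * indicator A w \<partial>lborel)"
    by (simp add: nn_integral_lborel_translate[where f="?\<gamma> d"] nn_integral_isotropic_normal_density[OF d]
        del: uminus_add_conv_diff)
  also have "\<dots> = emeasure (isotropic_normal c) A"
    by (simp add: nn_integral_isotropic_normal[symmetric])
  finally show "emeasure (isotropic_normal a \<star> isotropic_normal b) A =
      emeasure (isotropic_normal (sqrt (a\<^sup>2 + b\<^sup>2))) A"
    by (simp add: c_def)
qed simp

section \<open>Exponential moments and integrability\<close>

lemma nn_integral_exp_inner_isotropic_normal:
  fixes v :: "real ^ 'n"
  assumes "s > 0"
  shows "(\<integral>\<^sup>+x. ennreal (exp (v \<bullet> x)) \<partial>isotropic_normal s) = ennreal (exp (s\<^sup>2 * (norm v)\<^sup>2 / 2))"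
proof -
  \<comment> \<open>Exponential tilting: completing the square turns the tilted density into a
    constant times the density centred at \<open>s\<^sup>2 *\<^sub>R v\<close>.\<close>
  have "isotropic_normal_density s x * exp (v \<bullet> x) =
      exp (s\<^sup>2 * (norm v)\<^sup>2 / 2) * isotropic_normal_density s (- (s\<^sup>2 *\<^sub>R v) + x)" for x
  proof -
    have "(norm (- (s\<^sup>2 *\<^sub>R v) + x))\<^sup>2 = s\<^sup>2 * s\<^sup>2 * (norm v)\<^sup>2 - 2 * s\<^sup>2 * (v \<bullet> x) + (norm x)\<^sup>2"
      by (simp only: power2_norm_eq_inner) (simp add: algebra_simps inner_commute power2_eq_square)
    then have "- (norm x)\<^sup>2 / (2 * s\<^sup>2) + v \<bullet> x =
        s\<^sup>2 * (norm v)\<^sup>2 / 2 + - (norm (- (s\<^sup>2 *\<^sub>R v) + x))\<^sup>2 / (2 * s\<^sup>2)"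
      using assms by (simp add: field_simps)
    then show ?thesis
      using assms by (simp add: isotropic_normal_density_eq_exp exp_add[symmetric] mult_ac del: minus_add_distrib)
  qed
  then have "(\<integral>\<^sup>+x. ennreal (exp (v \<bullet> x)) \<partial>isotropic_normal s) =
      (\<integral>\<^sup>+x. ennreal (exp (s\<^sup>2 * (norm v)\<^sup>2 / 2)) *
        ennreal (isotropic_normal_density s (- (s\<^sup>2 *\<^sub>R v) + x)) \<partial>lborel)"
    by (simp add: nn_integral_isotropic_normal ennreal_mult[symmetric])
  also have "\<dots> = ennreal (exp (s\<^sup>2 * (norm v)\<^sup>2 / 2)) *
      (\<integral>\<^sup>+x. ennreal (isotropic_normal_density s (- (s\<^sup>2 *\<^sub>R v) + x)) \<partial>lborel)"
    by (rule nn_integral_cmult) measurable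
  also have "(\<integral>\<^sup>+x. ennreal (isotropic_normal_density s (- (s\<^sup>2 *\<^sub>R v) + x)) \<partial>lborel) = 1"
    by (subst nn_integral_lborel_translate[where f="\<lambda>x. ennreal (isotropic_normal_density s x)"])
      (simp_all add: nn_integral_isotropic_normal_density[OF assms])
  finally show ?thesis by simp
qed

text \<open>The integrand times the density is dominated by a multiple of the density with doubled
  standard deviation, because part of the quadratic exponent is enough to absorb the linear term
  \<open>c * norm x\<close>.\<close>

lemma integrable_exp_norm_isotropic_normal:
  assumes "s > 0"
  shows "integrable (isotropic_normal s) (\<lambda>x::real ^ 'n. exp (c * norm x))"
proof (rule integrableI_bounded)
  show "(\<lambda>x::real ^ 'n. exp (c * norm x)) \<in> borel_measurable (isotropic_normal s)"
    by measurable
  \<comment> \<open>The power of 2 is the ratio of the two normalising constants; the exponential is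
    the price of the inequality \<open>c * norm x \<le> c\<^sup>2 * s\<^sup>2 + (norm x)\<^sup>2 /
    (4 * s\<^sup>2)\<close>.\<close>
  define K where "K = 2 ^ CARD('n) * exp (c\<^sup>2 * s\<^sup>2)"
  have bd: "isotropic_normal_density s x * exp (c * norm x) \<le> K * isotropic_normal_density (2 * s) x"
    for x :: "real ^ 'n"
  proof -
    have "0 \<le> (c * s - norm x / (2 * s))\<^sup>2" by simp
    then have "c * norm x \<le> c\<^sup>2 * s\<^sup>2 + (norm x)\<^sup>2 / (4 * s\<^sup>2)"
      using assms by (simp add: power2_eq_square field_simps)
    moreover have "(norm x)\<^sup>2 / (4 * s\<^sup>2) \<le> (norm x)\<^sup>2 / (2 * s\<^sup>2) - (norm x)\<^sup>2 / (2 * (2 * s)\<^sup>2)"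
      using assms by (simp add: field_simps)
    ultimately have e: "- (norm x)\<^sup>2 / (2 * s\<^sup>2) + c * norm x \<le>
        c\<^sup>2 * s\<^sup>2 + - (norm x)\<^sup>2 / (2 * (2 * s)\<^sup>2)"
      by simp
    have "sqrt (2 * pi * (2 * s)\<^sup>2) = 2 * sqrt (2 * pi * s\<^sup>2)"
      using assms by (simp only: real_sqrt_mult real_sqrt_abs)
    then have "2 * (1 / sqrt (2 * pi * (2 * s)\<^sup>2)) = 1 / sqrt (2 * pi * s\<^sup>2)"
      by simp
    then have k: "2 ^ CARD('n) * (1 / sqrt (2 * pi * (2 * s)\<^sup>2)) ^ CARD('n) =
        (1 / sqrt (2 * pi * s\<^sup>2)) ^ CARD('n)"
      by (simp only: power_mult_distrib[symmetric])
    have "isotropic_normal_density s x * exp (c * norm x) =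
        (1 / sqrt (2 * pi * s\<^sup>2)) ^ CARD('n) * exp (- (norm x)\<^sup>2 / (2 * s\<^sup>2) + c * norm x)"
      by (simp only: isotropic_normal_density_eq_exp[OF assms] exp_add mult.assoc)
    also have "\<dots> \<le> (1 / sqrt (2 * pi * s\<^sup>2)) ^ CARD('n) *
        exp (c\<^sup>2 * s\<^sup>2 + - (norm x)\<^sup>2 / (2 * (2 * s)\<^sup>2))"
      using e by (intro mult_left_mono) auto
    also have "\<dots> = K * isotropic_normal_density (2 * s) x"
      using assms unfolding k[symmetric] K_def
      by (subst isotropic_normal_density_eq_exp) (simp_all only: exp_add mult_ac)
    finally show ?thesis .
  qed
  have "(\<integral>\<^sup>+(x::real ^ 'n). ennreal (norm (exp (c * norm x))) \<partial>isotropic_normal s) =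
      (\<integral>\<^sup>+(x::real ^ 'n). ennreal (isotropic_normal_density s x * exp (c * norm x)) \<partial>lborel)"
    by (simp add: nn_integral_isotropic_normal ennreal_mult)
  also have "\<dots> \<le> (\<integral>\<^sup>+(x::real ^ 'n). ennreal K * ennreal (isotropic_normal_density (2 * s) x) \<partial>lborel)"
    by (intro nn_integral_mono) (use bd in \<open>auto simp: ennreal_mult'[symmetric] K_def intro!: ennreal_leI\<close>)
  also have "\<dots> = ennreal K"
    using assms by (subst nn_integral_cmult) (auto simp: nn_integral_isotropic_normal_density)
  also have "\<dots> < \<infinity>" by simp
  finally show "(\<integral>\<^sup>+(x::real ^ 'n). ennreal (norm (exp (c * norm x))) \<partial>isotropic_normal s) < \<infinity>" .
qed

lemma integrable_isotropic_normal_exp_bound: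
  fixes f :: "real ^ 'n \<Rightarrow> 'b::{banach, second_countable_topology}"
  assumes "s > 0" "f \<in> borel_measurable borel" "\<And>x. norm (f x) \<le> K * exp (c * norm x)"
  shows "integrable (isotropic_normal s) f"
  by (rule Bochner_Integration.integrable_bound[where f="\<lambda>x. K * exp (c * norm x)"])
    (use assms in \<open>auto simp: integrable_exp_norm_isotropic_normal intro: order_trans[OF _ abs_ge_self]\<close>)

lemma integral_isotropic_normal_uminus:
  fixes f :: "real ^ 'n \<Rightarrow> real"
  assumes "s > 0" and [measurable]: "f \<in> borel_measurable borel"
  shows "(\<integral>x. f (- x) \<partial>isotropic_normal s) = (\<integral>x. f x \<partial>isotropic_normal s)"
proof -
  have "(\<integral>x. f x \<partial>isotropic_normal s) =
      (\<integral>x. f x \<partial>distr (isotropic_normal s) borel (\<lambda>x. (- 1) *\<^sub>R x))"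
    by (subst distr_isotropic_normal_scaleR[OF assms(1)]) simp_all
  also have "\<dots> = (\<integral>x. f (- x) \<partial>isotropic_normal s)"
    by (subst integral_distr) auto
  finally show ?thesis ..
qed

text \<open>By symmetry: the integrand is odd and the measure is invariant under reflection.\<close>

lemma integral_inner_isotropic_normal:
  assumes "s > 0"
  shows "(\<integral>x. v \<bullet> x \<partial>isotropic_normal s) = 0"
  using integral_isotropic_normal_uminus[OF assms, of "\<lambda>x. v \<bullet> x"] by simp

subsection \<open>Gaussian averages of smooth contractions\<close>

text \<open>
  Carrying \<open>v\<close> as an explicit measurable argument, instead of a derivative of \<open>F\<close>, makes the
  class stable under \<open>heat\<close> without differentiating under the integral sign.
\<close>

definition smooth_contraction ::
    "real \<Rightarrow> (real ^ 'n \<Rightarrow> real) \<Rightarrow> (real ^ 'n \<Rightarrow> real ^ 'n) \<Rightarrow> bool" where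
  "smooth_contraction C F v \<longleftrightarrow>
    v \<in> borel_measurable borel \<and>
    (\<forall>x. norm (v x) \<le> 1) \<and>
    (\<forall>x y. \<bar>F x - F y\<bar> \<le> norm (x - y)) \<and>
    (\<forall>x h. \<bar>F (x + h) - F x - v x \<bullet> h\<bar> \<le> C * (norm h)\<^sup>2)"

text \<open>This is the heat semigroup indexed by standard deviation instead of time, so composition
  adds the squares of the indices. The target type is general because both a function and its vector
  field \<open>v\<close> are averaged.\<close>

definition heat :: "real \<Rightarrow> (real ^ 'n \<Rightarrow> 'b::{banach, second_countable_topology}) \<Rightarrow> real ^ 'n \<Rightarrow> 'b" where
  "heat s f x = (\<integral>h. f (x + h) \<partial>isotropic_normal s)"

lemma smooth_contractionD:
  assumes "smooth_contraction C F v"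
  shows "v \<in> borel_measurable borel" "norm (v x) \<le> 1" "\<bar>F x - F y\<bar> \<le> norm (x - y)"
    "\<bar>F (x + h) - F x - v x \<bullet> h\<bar> \<le> C * (norm h)\<^sup>2"
  using assms by (auto simp: smooth_contraction_def)

lemma smooth_contraction_borel_measurable:
  assumes "smooth_contraction C F v"
  shows "F \<in> borel_measurable borel"
proof (rule borel_measurable_continuous_onI)
  show "continuous_on UNIV F"
    unfolding continuous_on_iff
    using smooth_contractionD(3)[OF assms] by (auto simp: dist_norm intro: le_less_trans)
qed

lemma nonneg_le_exp: "0 \<le> (t::real) \<Longrightarrow> t \<le> exp t"
  using exp_ge_add_one_self[of t] by linarith

lemma smooth_contraction_integrable:
  assumes "smooth_contraction C F v" "s > 0"
  shows "integrable (isotropic_normal s) (\<lambda>h. F (x + h))"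
    and "integrable (isotropic_normal s) (\<lambda>h. v (x + h))"
proof -
  note [measurable] = smooth_contraction_borel_measurable[OF assms(1)] smooth_contractionD(1)[OF assms(1)]
  show "integrable (isotropic_normal s) (\<lambda>h. F (x + h))"
  proof (rule integrable_isotropic_normal_exp_bound[OF assms(2), where K="\<bar>F x\<bar> + 1" and c=1])
    fix h
    have "\<bar>F (x + h)\<bar> \<le> \<bar>F x\<bar> * 1 + norm h"
      using smooth_contractionD(3)[OF assms(1), of "x + h" x] by simp
    also have "\<dots> \<le> \<bar>F x\<bar> * exp (norm h) + exp (norm h)"
      by (intro add_mono mult_left_mono nonneg_le_exp) auto
    finally show "norm (F (x + h)) \<le> (\<bar>F x\<bar> + 1) * exp (1 * norm h)"
      by (simp add: algebra_simps)
  qed measurable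
  show "integrable (isotropic_normal s) (\<lambda>h. v (x + h))"
    by (rule integrable_isotropic_normal_exp_bound[OF assms(2), where K=1 and c=0])
      (use smooth_contractionD(2)[OF assms(1)] in auto)
qed

text \<open>All the defining bounds are uniform in the base point, so averaging over translates
  preserves them with the same \<open>C\<close>. In particular the remainder of the average is the
  average of the remainders at the translated points.\<close>

lemma smooth_contraction_heat:
  assumes F: "smooth_contraction C F v" and "s > 0"
  shows "smooth_contraction C (heat s F) (heat s v)"
proof -
  interpret prob_space "isotropic_normal s :: (real ^ 'a) measure"
    by (rule prob_space_isotropic_normal[OF assms(2)])
  note [measurable] = smooth_contraction_borel_measurable[OF F] smooth_contractionD(1)[OF F]
  note int[simp] = smooth_contraction_integrable[OF F \<open>s > 0\<close>]
  have [simp]: "integrable (isotropic_normal s) (\<lambda>k. v (x + k) \<bullet> h)" for x h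
    by (intro integrable_inner_left int)
  show ?thesis
    unfolding smooth_contraction_def
  proof (intro conjI allI)
    show "heat s v \<in> borel_measurable borel"
      unfolding heat_def[abs_def] by measurable
    fix x y h
    have "norm (heat s v x) \<le> (\<integral>h. norm (v (x + h)) \<partial>isotropic_normal s)"
      unfolding heat_def by simp
    also have "\<dots> \<le> (\<integral>h. 1 \<partial>(isotropic_normal s :: (real ^ 'a) measure))"
      by (intro integral_mono) (auto intro: smooth_contractionD[OF F])
    finally show "norm (heat s v x) \<le> 1"
      by (simp add: prob_space[simplified])
    have "\<bar>heat s F x - heat s F y\<bar> = \<bar>\<integral>h. F (x + h) - F (y + h) \<partial>isotropic_normal s\<bar>"
      unfolding heat_def by simp
    also have "\<dots> \<le> (\<integral>h. \<bar>F (x + h) - F (y + h)\<bar> \<partial>isotropic_normal s)"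
      by (rule integral_abs_bound)
    also have "\<dots> \<le> (\<integral>h. norm (x - y) \<partial>(isotropic_normal s :: (real ^ 'a) measure))"
      by (intro integral_mono) (auto intro: order_trans[OF smooth_contractionD(3)[OF F]])
    finally show "\<bar>heat s F x - heat s F y\<bar> \<le> norm (x - y)"
      by (simp add: prob_space[simplified])
    have "\<bar>heat s F (x + h) - heat s F x - heat s v x \<bullet> h\<bar> =
        \<bar>\<integral>k. F ((x + k) + h) - F (x + k) - v (x + k) \<bullet> h \<partial>isotropic_normal s\<bar>"
    proof -
      have "integrable (isotropic_normal s) (\<lambda>k. F ((x + k) + h))"
        using int(1)[of "x + h"] by (simp add: ac_simps)
      moreover have "heat s F (x + h) = (\<integral>k. F ((x + k) + h) \<partial>isotropic_normal s)"
        by (simp add: heat_def ac_simps)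
      ultimately show ?thesis
        by (simp add: heat_def[of s F x] heat_def[of s v])
    qed
    also have "\<dots> \<le> (\<integral>k. \<bar>F ((x + k) + h) - F (x + k) - v (x + k) \<bullet> h\<bar> \<partial>isotropic_normal s)"
      by (rule integral_abs_bound)
    also have "\<dots> \<le> (\<integral>k. C * (norm h)\<^sup>2 \<partial>(isotropic_normal s :: (real ^ 'a) measure))"
    proof (intro integral_mono)
      have "integrable (isotropic_normal s) (\<lambda>k. F ((x + k) + h))"
        using int(1)[of "x + h"] by (simp add: ac_simps)
      then show "integrable (isotropic_normal s) (\<lambda>k. \<bar>F ((x + k) + h) - F (x + k) - v (x + k) \<bullet> h\<bar>)"
        by simp
    qed (auto intro: smooth_contractionD[OF F])
    finally show "\<bar>heat s F (x + h) - heat s F x - heat s v x \<bullet> h\<bar> \<le> C * (norm h)\<^sup>2"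
      by (simp add: prob_space[simplified])
  qed
qed

lemma heat_heat:
  assumes F: "smooth_contraction C F v" and "a > 0" "b > 0"
  shows "heat a (heat b F) x = heat (sqrt (a\<^sup>2 + b\<^sup>2)) F x"
proof -
  interpret A: prob_space "isotropic_normal a :: (real ^ 'a) measure"
    by (rule prob_space_isotropic_normal[OF assms(2)])
  interpret B: prob_space "isotropic_normal b :: (real ^ 'a) measure"
    by (rule prob_space_isotropic_normal[OF assms(3)])
  interpret AB: pair_sigma_finite "isotropic_normal a :: (real ^ 'a) measure"
    "isotropic_normal b :: (real ^ 'a) measure" ..
  note [measurable] = smooth_contraction_borel_measurable[OF F]
  have c: "sqrt (a\<^sup>2 + b\<^sup>2) > 0"
    using assms by (simp add: add_pos_pos)
  have conv: "isotropic_normal (sqrt (a\<^sup>2 + b\<^sup>2)) =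
      distr (isotropic_normal a \<Otimes>\<^sub>M isotropic_normal b) borel (\<lambda>(y, z). y + z :: real ^ 'a)"
    using convolution_isotropic_normal[OF assms(2,3), where 'n='a] by (simp add: convolution_def)
  \<comment> \<open>Fubini for the signed function \<open>F\<close> requires joint integrability. It
    is pulled back from integrability under the law of the sum, which is the Gaussian given by
    \<open>conv\<close>.\<close>
  have "integrable (isotropic_normal a \<Otimes>\<^sub>M isotropic_normal b) (\<lambda>(y, z). F (x + (y + z)))"
    using smooth_contraction_integrable(1)[OF F c, of x] unfolding conv
    by (subst (asm) integrable_distr_eq) (auto simp: split_beta')
  then have "(\<integral>y. \<integral>z. F (x + (y + z)) \<partial>isotropic_normal b \<partial>isotropic_normal a) =
      (\<integral>p. (case p of (y, z) \<Rightarrow> F (x + (y + z))) \<partial>(isotropic_normal a \<Otimes>\<^sub>M isotropic_normal b))"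
    by (simp add: AB.integral_fst'[symmetric])
  also have "\<dots> = heat (sqrt (a\<^sup>2 + b\<^sup>2)) F x"
    unfolding heat_def conv by (subst integral_distr) (auto simp: split_beta')
  finally show ?thesis
    by (simp add: heat_def add.assoc)
qed

text \<open>Bounds the last two terms of the identity \<open>exp (a + b) = exp a + b + (exp a - 1) *
  b + exp a * (exp b - 1 - b)\<close>. The summand \<open>b\<close> is kept free of any factor
  because it will be a centred random variable, whose expectation vanishes.\<close>

lemma exp_add_le_second_order:
  fixes a b :: real
  shows "exp (a + b) \<le> exp a + b + \<bar>a\<bar> * \<bar>b\<bar> * exp \<bar>a\<bar> + b\<^sup>2 * exp (\<bar>a\<bar> + \<bar>b\<bar>)"
proof -
  have lin: "exp t - 1 - t \<ge> 0" for t :: real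
    using exp_ge_add_one_self[of t] by linarith
  have fst: "\<bar>exp t - 1\<bar> \<le> \<bar>t\<bar> * exp \<bar>t\<bar>" for t :: real
  proof -
    have "1 - t \<le> exp (- t)" using lin[of "- t"] by simp
    then have "(1 - t) * exp t \<le> exp (- t) * exp t" by (intro mult_right_mono) auto
    then have up: "exp t - 1 \<le> t * exp t"
      by (simp add: exp_minus algebra_simps)
    show ?thesis
    proof (cases "t \<ge> 0")
      case True
      then show ?thesis using up by simp
    next
      case False
      then have "- t * 1 \<le> - t * exp (- t)" by (intro mult_left_mono) auto
      moreover have "\<bar>exp t - 1\<bar> = 1 - exp t" "\<bar>t\<bar> = - t" using False by simp_all
      ultimately show ?thesis using lin[of t] by simp
    qed
  qed
  have "exp b - 1 - b \<le> b\<^sup>2 * exp \<bar>b\<bar>"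
  proof -
    have "1 - b \<le> exp (- b)" using lin[of "- b"] by simp
    then have "(1 - b) * exp b \<le> exp (- b) * exp b" by (intro mult_right_mono) auto
    then have "exp b - 1 - b \<le> b * (exp b - 1)"
      by (simp add: exp_minus algebra_simps)
    also have "\<dots> \<le> \<bar>b\<bar> * \<bar>exp b - 1\<bar>"
      by (simp add: abs_mult[symmetric])
    also have "\<dots> \<le> \<bar>b\<bar> * (\<bar>b\<bar> * exp \<bar>b\<bar>)"
      by (intro mult_left_mono fst) auto
    finally show ?thesis by (simp add: power2_eq_square)
  qed
  then have "exp a * (exp b - 1 - b) \<le> exp \<bar>a\<bar> * (b\<^sup>2 * exp \<bar>b\<bar>)"
    using lin[of b] by (intro mult_mono) auto
  moreover have "(exp a - 1) * b \<le> \<bar>a\<bar> * exp \<bar>a\<bar> * \<bar>b\<bar>"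
  proof -
    have "(exp a - 1) * b \<le> \<bar>exp a - 1\<bar> * \<bar>b\<bar>"
      by (simp add: abs_mult[symmetric])
    also have "\<dots> \<le> \<bar>a\<bar> * exp \<bar>a\<bar> * \<bar>b\<bar>"
      by (intro mult_right_mono fst) auto
    finally show ?thesis .
  qed
  ultimately show ?thesis
    by (simp add: exp_add algebra_simps)
qed

lemma square_le_two_exp: "0 \<le> (t::real) \<Longrightarrow> t\<^sup>2 \<le> 2 * exp t"
  using exp_lower_Taylor_quadratic[of t] by simp

text \<open>Moving to the standard Gaussian puts \<open>s\<close> inside the integrand, where the
  order in \<open>s\<close> of each term can be read off.\<close>

lemma heat_scale:
  assumes [measurable]: "F \<in> borel_measurable borel" and "s > 0"
  shows "heat s F x = (\<integral>g. F (x + s *\<^sub>R g) \<partial>isotropic_normal 1)"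
proof -
  have "heat s F x = (\<integral>h. F (x + h) \<partial>distr (isotropic_normal 1) borel (\<lambda>g. s *\<^sub>R g))"
    using assms(2) by (simp add: heat_def distr_isotropic_normal_scaleR)
  also have "\<dots> = (\<integral>g. F (x + s *\<^sub>R g) \<partial>isotropic_normal 1)"
    by (subst integral_distr) auto
  finally show ?thesis .
qed

lemma nn_integral_isotropic_normal_scale:
  assumes [measurable]: "f \<in> borel_measurable borel" and "s > 0"
  shows "(\<integral>\<^sup>+x. f x \<partial>isotropic_normal s) = (\<integral>\<^sup>+g. f (s *\<^sub>R g) \<partial>isotropic_normal 1)"
proof -
  have "(\<integral>\<^sup>+x. f x \<partial>isotropic_normal s) = (\<integral>\<^sup>+x. f x \<partial>distr (isotropic_normal 1) borel (\<lambda>g. s *\<^sub>R g))"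
    using assms(2) by (simp add: distr_isotropic_normal_scaleR)
  also have "\<dots> = (\<integral>\<^sup>+g. f (s *\<^sub>R g) \<partial>isotropic_normal 1)"
    by (subst nn_integral_distr) auto
  finally show ?thesis .
qed

text \<open>
  The remainder \<open>K * s ^ 3\<close> is what makes the iteration sharp: over \<open>N = 1 / s\<^sup>2\<close> steps it adds up
  to \<open>K / sqrt N\<close>. The second-order remainder of \<open>F\<close> alone is only of order \<open>s\<^sup>2\<close>; it has to be
  centred, and enters through its product with the linear term.
\<close>

lemma exp_moment_small_time:
  fixes C l :: real
  assumes "C \<ge> 0" "l \<ge> 0"
  obtains K where "K \<ge> 0"
    "\<And>(F :: real ^ 'n \<Rightarrow> real) v x s. smooth_contraction C F v \<Longrightarrow> 0 < s \<Longrightarrow> s \<le> 1 \<Longrightarrow>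
      (\<integral>\<^sup>+h. ennreal (exp (l * F (x + h))) \<partial>isotropic_normal s)
        \<le> ennreal (exp (l * heat s F x + l\<^sup>2 * s\<^sup>2 / 2 + K * s ^ 3))"
proof -
  let ?\<gamma> = "isotropic_normal 1 :: (real ^ 'n) measure"
  interpret prob_space ?\<gamma> by (rule prob_space_isotropic_normal) simp
  define m1 where "m1 = (\<integral>g. norm g \<partial>?\<gamma>)"
  define m2 where "m2 = (\<integral>g. (norm g)\<^sup>2 \<partial>?\<gamma>)"
  have m: "m1 \<ge> 0" "m2 \<ge> 0" by (simp_all add: m1_def m2_def)
  \<comment> \<open>The constants \<open>L\<close> and \<open>K0\<close> and the majorant
    \<open>\<Psi>\<close> are those needed in \<open>b_bd\<close> and \<open>pw\<close> below. They
    depend only on \<open>C\<close>, \<open>l\<close> and the dimension, since \<open>K\<close> has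
    to serve every \<open>F\<close>, \<open>x\<close> and \<open>s\<close> at once.\<close>
  define L where "L = l * C * (2 + m2)"
  have L: "L \<ge> 0" using assms m by (simp add: L_def)
  define K0 where "K0 = l * L + L\<^sup>2 * exp (2 * l * m1)"
  have K0: "K0 \<ge> 0" using assms L by (simp add: K0_def)
  define \<Psi> where "\<Psi> g = K0 * exp ((3 * l + 2) * norm g)" for g :: "real ^ 'n"
  have int_\<Psi>: "integrable ?\<gamma> \<Psi>"
    unfolding \<Psi>_def[abs_def] by (simp add: integrable_exp_norm_isotropic_normal)
  have int1: "integrable ?\<gamma> (\<lambda>g. norm g)"
    by (rule integrable_isotropic_normal_exp_bound[where K=1 and c=1]) (auto intro: nonneg_le_exp)
  have int2: "integrable ?\<gamma> (\<lambda>g. (norm g)\<^sup>2)"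
    by (rule integrable_isotropic_normal_exp_bound[where K=2 and c=1]) (auto intro: square_le_two_exp)
  define K where "K = (\<integral>g. \<Psi> g \<partial>?\<gamma>)"
  have "K \<ge> 0" using K0 by (simp add: K_def \<Psi>_def)
  moreover have "(\<integral>\<^sup>+h. ennreal (exp (l * F (x + h))) \<partial>isotropic_normal s)
      \<le> ennreal (exp (l * heat s F x + l\<^sup>2 * s\<^sup>2 / 2 + K * s ^ 3))"
    if F: "smooth_contraction C F v" and s: "0 < s" "s \<le> 1"
    for F :: "real ^ 'n \<Rightarrow> real" and v x s
  proof -
    note [measurable] = smooth_contraction_borel_measurable[OF F]
    define r where "r g = F (x + s *\<^sub>R g) - F x - s * (v x \<bullet> g)" for g
    have [measurable]: "r \<in> borel_measurable borel" unfolding r_def[abs_def] by measurable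
    \<comment> \<open>The remainder gets two bounds: the linear one keeps exponentials of it
      integrable, the quadratic one supplies the factor \<open>s\<^sup>2\<close>.\<close>
    have r1: "\<bar>r g\<bar> \<le> 2 * norm g" for g
    proof -
      have "\<bar>F (x + s *\<^sub>R g) - F x\<bar> \<le> s * norm g"
        using smooth_contractionD(3)[OF F, of "x + s *\<^sub>R g" x] s by simp
      moreover have "\<bar>v x \<bullet> g\<bar> \<le> 1 * norm g"
        using Cauchy_Schwarz_ineq2[of "v x" g] smooth_contractionD(2)[OF F, of x]
        by (meson mult_right_mono norm_ge_zero order_trans)
      then have "\<bar>s * (v x \<bullet> g)\<bar> \<le> s * norm g"
        using s by (simp add: abs_mult)
      moreover have "s * norm g \<le> 1 * norm g"
        using s by (intro mult_right_mono) auto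
      ultimately show ?thesis by (simp add: r_def)
    qed
    have r2: "\<bar>r g\<bar> \<le> C * s\<^sup>2 * (norm g)\<^sup>2" for g
      using smooth_contractionD(4)[OF F, of x "s *\<^sub>R g"] by (simp add: r_def power_mult_distrib mult.assoc)
    have int_r: "integrable ?\<gamma> r"
      by (rule Bochner_Integration.integrable_bound[where f="\<lambda>g. 2 * norm g"]) (use int1 r1 in auto)
    have int_v: "integrable ?\<gamma> (\<lambda>g. v x \<bullet> g)"
      by (rule Bochner_Integration.integrable_bound[where f="\<lambda>g. norm (v x) * norm g"])
        (use int1 Cauchy_Schwarz_ineq2 in auto)
    define m where "m = (\<integral>g. r g \<partial>?\<gamma>)"
    have heat: "heat s F x = F x + m"
    proof -
      have "heat s F x = (\<integral>g. F x + s * (v x \<bullet> g) + r g \<partial>?\<gamma>)"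
        using s by (simp add: heat_scale r_def)
      also have "\<dots> = F x + m"
        using int_r int_v by (simp add: m_def integral_inner_isotropic_normal prob_space[simplified])
      finally show ?thesis .
    qed
    have m1: "\<bar>m\<bar> \<le> 2 * m1"
    proof -
      have "\<bar>m\<bar> \<le> (\<integral>g. \<bar>r g\<bar> \<partial>?\<gamma>)" unfolding m_def by (rule integral_abs_bound)
      also have "\<dots> \<le> (\<integral>g. 2 * norm g \<partial>?\<gamma>)"
        using int_r int1 r1 by (intro integral_mono) auto
      finally show ?thesis by (simp add: m1_def)
    qed
    have m2: "\<bar>m\<bar> \<le> C * s\<^sup>2 * m2"
    proof -
      have "\<bar>m\<bar> \<le> (\<integral>g. \<bar>r g\<bar> \<partial>?\<gamma>)" unfolding m_def by (rule integral_abs_bound)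
      also have "\<dots> \<le> (\<integral>g. C * s\<^sup>2 * (norm g)\<^sup>2 \<partial>?\<gamma>)"
        using int_r int2 r2 by (intro integral_mono) auto
      finally show ?thesis by (simp add: m2_def)
    qed
    \<comment> \<open>The centred exponent is split into its linear part \<open>a\<close>, of order
      \<open>s\<close>, and the centred remainder \<open>b\<close>, of order
      \<open>s\<^sup>2\<close> and mean zero.\<close>
    define a where "a g = l * s * (v x \<bullet> g)" for g
    define b where "b g = l * (r g - m)" for g
    have ab: "l * (F (x + s *\<^sub>R g) - heat s F x) = a g + b g" for g
      by (simp add: heat a_def b_def r_def algebra_simps)
    have a_bd: "\<bar>a g\<bar> \<le> l * s * norm g" for g
    proof -
      have "\<bar>v x \<bullet> g\<bar> \<le> 1 * norm g"
        using Cauchy_Schwarz_ineq2[of "v x" g] smooth_contractionD(2)[OF F, of x]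
        by (meson mult_right_mono norm_ge_zero order_trans)
      then show ?thesis
        using s assms by (simp add: a_def abs_mult mult_left_mono)
    qed
    have a_bd': "\<bar>a g\<bar> \<le> l * norm g" for g
    proof -
      have "l * s * norm g \<le> l * 1 * norm g"
        using s assms by (intro mult_right_mono mult_left_mono) auto
      then show ?thesis using a_bd[of g] by simp
    qed
    have b_bd': "\<bar>b g\<bar> \<le> 2 * l * norm g + 2 * l * m1" for g
    proof -
      have "\<bar>b g\<bar> = l * \<bar>r g - m\<bar>" using assms by (simp add: b_def abs_mult)
      also have "\<dots> \<le> l * (2 * norm g + 2 * m1)"
        using r1[of g] m1 assms by (intro mult_left_mono) linarith+
      finally show ?thesis by (simp add: algebra_simps)
    qed
    have b_bd: "\<bar>b g\<bar> \<le> L * s\<^sup>2 * exp (norm g)" for g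
    proof -
      have "\<bar>b g\<bar> = l * \<bar>r g - m\<bar>" using assms by (simp add: b_def abs_mult)
      also have "\<dots> \<le> l * (C * s\<^sup>2 * (norm g)\<^sup>2 + C * s\<^sup>2 * m2)"
        using r2[of g] m2 assms by (intro mult_left_mono) linarith+
      also have "\<dots> = l * (C * s\<^sup>2) * ((norm g)\<^sup>2 + m2 * 1)"
        by (simp add: algebra_simps)
      also have "\<dots> \<le> l * (C * s\<^sup>2) * (2 * exp (norm g) + m2 * exp (norm g))"
        using assms m by (intro mult_left_mono add_mono square_le_two_exp) auto
      finally show ?thesis by (simp add: L_def algebra_simps)
    qed
    \<comment> \<open>The mixed term is of order \<open>s * s\<^sup>2\<close>. The term quadratic in
      \<open>b\<close> is of order \<open>s ^ 4\<close>, which is at most \<open>s ^ 3\<close>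
      because \<open>s \<le> 1\<close>. Both exponential factors fit under
      \<open>exp ((3 * l + 2) * norm g)\<close>.\<close>
    have pw: "exp (a g + b g) \<le> exp (a g) + b g + s ^ 3 * \<Psi> g" for g
    proof -
      let ?e = "exp (norm g)"
      have A: "\<bar>a g\<bar> \<le> l * s * ?e"
        using a_bd[of g] s assms nonneg_le_exp[of "norm g"]
        by (meson mult_left_mono mult_nonneg_nonneg norm_ge_zero order_trans less_imp_le)
      have "\<bar>a g\<bar> * \<bar>b g\<bar> * exp \<bar>a g\<bar> \<le> (l * s * ?e) * (L * s\<^sup>2 * ?e) * exp (l * norm g)"
        using A b_bd[of g] a_bd'[of g] s assms L by (intro mult_mono) auto
      also have "\<dots> = s ^ 3 * (l * L * exp ((l + 2) * norm g))"
        by (simp add: power2_eq_square power3_eq_cube mult_exp_exp algebra_simps)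
      also have "\<dots> \<le> s ^ 3 * (l * L * exp ((3 * l + 2) * norm g))"
        using s assms L by (intro mult_left_mono) (auto intro!: mult_right_mono)
      finally have 1: "\<bar>a g\<bar> * \<bar>b g\<bar> * exp \<bar>a g\<bar> \<le> s ^ 3 * (l * L * exp ((3 * l + 2) * norm g))" .
      have "(b g)\<^sup>2 * exp (\<bar>a g\<bar> + \<bar>b g\<bar>) \<le>
          (L * s\<^sup>2 * ?e)\<^sup>2 * exp (l * norm g + (2 * l * norm g + 2 * l * m1))"
        using a_bd'[of g] b_bd'[of g] b_bd[of g]
        by (intro mult_mono) (auto simp: abs_le_square_iff[symmetric])
      also have "\<dots> = s ^ 4 * (L\<^sup>2 * exp (2 * l * m1) * exp ((3 * l + 2) * norm g))"
        by (simp add: power_mult_distrib exp_double[symmetric] mult_exp_exp algebra_simps)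
      also have "\<dots> \<le> s ^ 3 * (L\<^sup>2 * exp (2 * l * m1) * exp ((3 * l + 2) * norm g))"
        using s by (intro mult_right_mono power_decreasing) auto
      finally have 2: "(b g)\<^sup>2 * exp (\<bar>a g\<bar> + \<bar>b g\<bar>) \<le>
          s ^ 3 * (L\<^sup>2 * exp (2 * l * m1) * exp ((3 * l + 2) * norm g))" .
      have "s ^ 3 * \<Psi> g = s ^ 3 * (l * L * exp ((3 * l + 2) * norm g)) +
          s ^ 3 * (L\<^sup>2 * exp (2 * l * m1) * exp ((3 * l + 2) * norm g))"
        by (simp add: \<Psi>_def K0_def distrib_left distrib_right)
      then show ?thesis
        using exp_add_le_second_order[of "a g" "b g"] 1 2 by linarith
    qed
    have [measurable]: "a \<in> borel_measurable borel" "b \<in> borel_measurable borel"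
      unfolding a_def[abs_def] b_def[abs_def] by measurable
    have int_a: "integrable ?\<gamma> (\<lambda>g. exp (a g))"
      by (rule integrable_isotropic_normal_exp_bound[where K=1 and c=l])
        (use a_bd' in \<open>auto intro: order_trans[OF abs_ge_self]\<close>)
    \<comment> \<open>The linear part is treated exactly, by the Gaussian moment generating function
      with \<open>norm (v x) \<le> 1\<close>; this is the source of the sharp constant.\<close>
    have E_a: "(\<integral>g. exp (a g) \<partial>?\<gamma>) \<le> exp (l\<^sup>2 * s\<^sup>2 / 2)"
    proof -
      have "ennreal (\<integral>g. exp (a g) \<partial>?\<gamma>) = (\<integral>\<^sup>+g. ennreal (exp (a g)) \<partial>?\<gamma>)"
        using int_a by (subst nn_integral_eq_integral) auto
      also have "\<dots> = (\<integral>\<^sup>+g. ennreal (exp (((l * s) *\<^sub>R v x) \<bullet> g)) \<partial>?\<gamma>)"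
        by (simp add: a_def)
      also have "\<dots> = ennreal (exp (1\<^sup>2 * (norm ((l * s) *\<^sub>R v x))\<^sup>2 / 2))"
        by (rule nn_integral_exp_inner_isotropic_normal) simp
      also have "\<dots> \<le> ennreal (exp (l\<^sup>2 * s\<^sup>2 / 2))"
      proof -
        have "(norm (v x))\<^sup>2 \<le> 1"
          using smooth_contractionD(2)[OF F, of x] by (simp add: power_le_one)
        then have "(l * s)\<^sup>2 * (norm (v x))\<^sup>2 \<le> (l * s)\<^sup>2 * 1" by (intro mult_left_mono) auto
        then show ?thesis by (auto simp: power_mult_distrib intro!: ennreal_leI)
      qed
      finally show ?thesis by (subst (asm) ennreal_le_iff) auto
    qed
    have int_b: "integrable ?\<gamma> b" unfolding b_def[abs_def] using int_r by simp
    have E_b: "(\<integral>g. b g \<partial>?\<gamma>) = 0"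
      unfolding b_def using int_r by (simp add: m_def prob_space[simplified])
    have int_rhs: "integrable ?\<gamma> (\<lambda>g. exp (a g) + b g + s ^ 3 * \<Psi> g)"
      using int_a int_b int_\<Psi> by simp
    have nonneg: "0 \<le> exp (a g) + b g + s ^ 3 * \<Psi> g" for g
      using pw[of g] exp_ge_zero[of "a g + b g"] by linarith
    have "(\<integral>\<^sup>+g. ennreal (exp (a g + b g)) \<partial>?\<gamma>) \<le>
        (\<integral>\<^sup>+g. ennreal (exp (a g) + b g + s ^ 3 * \<Psi> g) \<partial>?\<gamma>)"
      by (intro nn_integral_mono ennreal_leI pw)
    also have "\<dots> = ennreal (\<integral>g. exp (a g) + b g + s ^ 3 * \<Psi> g \<partial>?\<gamma>)"
      using int_rhs nonneg by (intro nn_integral_eq_integral) auto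
    also have "(\<integral>g. exp (a g) + b g + s ^ 3 * \<Psi> g \<partial>?\<gamma>) = (\<integral>g. exp (a g) \<partial>?\<gamma>) + K * s ^ 3"
      using int_a int_b int_\<Psi> by (simp add: E_b K_def)
    \<comment> \<open>The additive error is made multiplicative, so that errors of successive steps
      add up in the exponent.\<close>
    also have "\<dots> \<le> exp (l\<^sup>2 * s\<^sup>2 / 2 + K * s ^ 3)"
    proof -
      have "K * s ^ 3 \<ge> 0" using \<open>K \<ge> 0\<close> s by simp
      then have "1 * (K * s ^ 3) \<le> exp (l\<^sup>2 * s\<^sup>2 / 2) * (K * s ^ 3)"
        by (intro mult_right_mono) auto
      then have "exp (l\<^sup>2 * s\<^sup>2 / 2) + K * s ^ 3 \<le> exp (l\<^sup>2 * s\<^sup>2 / 2) * (1 + K * s ^ 3)"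
        by (simp add: distrib_left)
      also have "\<dots> \<le> exp (l\<^sup>2 * s\<^sup>2 / 2) * exp (K * s ^ 3)"
        using exp_ge_add_one_self by (intro mult_left_mono) auto
      finally show ?thesis using E_a by (simp add: exp_add)
    qed
    finally have main: "(\<integral>\<^sup>+g. ennreal (exp (a g + b g)) \<partial>?\<gamma>) \<le> ennreal (exp (l\<^sup>2 * s\<^sup>2 / 2 + K * s ^ 3))"
      by (simp add: ennreal_leI)
    have "(\<integral>\<^sup>+h. ennreal (exp (l * F (x + h))) \<partial>isotropic_normal s) =
        (\<integral>\<^sup>+g. ennreal (exp (l * F (x + s *\<^sub>R g))) \<partial>?\<gamma>)"
      using s by (subst nn_integral_isotropic_normal_scale) auto
    also have "\<dots> = (\<integral>\<^sup>+g. ennreal (exp (l * heat s F x)) * ennreal (exp (a g + b g)) \<partial>?\<gamma>)"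
      by (simp add: ab[symmetric] ennreal_mult'[symmetric] mult_exp_exp algebra_simps)
    also have "\<dots> = ennreal (exp (l * heat s F x)) * (\<integral>\<^sup>+g. ennreal (exp (a g + b g)) \<partial>?\<gamma>)"
      by (rule nn_integral_cmult) measurable
    also have "\<dots> \<le> ennreal (exp (l * heat s F x)) * ennreal (exp (l\<^sup>2 * s\<^sup>2 / 2 + K * s ^ 3))"
      using main by (rule mult_left_mono) simp
    also have "\<dots> = ennreal (exp (l * heat s F x + l\<^sup>2 * s\<^sup>2 / 2 + K * s ^ 3))"
      by (simp add: ennreal_mult'[symmetric] mult_exp_exp add.assoc)
    finally show ?thesis .
  qed
  ultimately show thesis by (rule that)
qed

text \<open>Induction by conditioning on one step: the induction hypothesis, applied at the shifted
  point, handles the other \<open>Suc k\<close> steps and leaves the exponential of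
  \<open>l * heat t F\<close>. Since \<open>heat t F\<close> is again in the class with the same
  \<open>C\<close>, \<open>step\<close> applies to it. Counting from one step avoids the degenerate
  standard deviation 0.\<close>

lemma exp_moment_iterate:
  fixes C l \<epsilon> s :: real and F :: "real ^ 'n \<Rightarrow> real"
  assumes s: "s > 0"
    and step: "\<And>(F :: real ^ 'n \<Rightarrow> real) v x. smooth_contraction C F v \<Longrightarrow>
      (\<integral>\<^sup>+h. ennreal (exp (l * F (x + h))) \<partial>isotropic_normal s) \<le> ennreal (exp (l * heat s F x + \<epsilon>))"
    and F: "smooth_contraction C F v"
  shows "(\<integral>\<^sup>+h. ennreal (exp (l * F (x + h))) \<partial>isotropic_normal (sqrt (Suc k) * s))
    \<le> ennreal (exp (l * heat (sqrt (Suc k) * s) F x + Suc k * \<epsilon>))"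
proof (induction k arbitrary: x)
  case 0
  show ?case using step[OF F, of x] by simp
next
  case (Suc k)
  define t where "t = sqrt (Suc k) * s"
  have t: "t > 0" using s by (simp add: t_def)
  interpret S: prob_space "isotropic_normal s :: (real ^ 'n) measure"
    by (rule prob_space_isotropic_normal[OF s])
  interpret T: prob_space "isotropic_normal t :: (real ^ 'n) measure"
    by (rule prob_space_isotropic_normal[OF t])
  have st: "sqrt (s\<^sup>2 + t\<^sup>2) = sqrt (Suc (Suc k)) * s"
  proof -
    have "s\<^sup>2 + t\<^sup>2 = real (Suc (Suc k)) * s\<^sup>2"
      by (simp add: t_def power_mult_distrib algebra_simps)
    then show ?thesis using s by (simp only: real_sqrt_mult real_sqrt_abs)
  qed
  note [measurable] = smooth_contraction_borel_measurable[OF F]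
    smooth_contraction_borel_measurable[OF smooth_contraction_heat[OF F t]]
  have "(\<integral>\<^sup>+h. ennreal (exp (l * F (x + h))) \<partial>isotropic_normal (sqrt (Suc (Suc k)) * s)) =
      (\<integral>\<^sup>+h. ennreal (exp (l * F (x + h))) \<partial>(isotropic_normal s \<star> isotropic_normal t))"
    by (simp only: convolution_isotropic_normal[OF s t] st)
  also have "\<dots> = (\<integral>\<^sup>+y. \<integral>\<^sup>+z. ennreal (exp (l * F (x + (y + z)))) \<partial>isotropic_normal t \<partial>isotropic_normal s)"
    by (rule nn_integral_convolution) (auto intro: S.finite_measure_axioms T.finite_measure_axioms)
  also have "\<dots> \<le> (\<integral>\<^sup>+y. ennreal (exp (l * heat t F (x + y) + Suc k * \<epsilon>)) \<partial>isotropic_normal s)"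
    by (intro nn_integral_mono) (use Suc.IH[folded t_def] in \<open>simp add: add.assoc[symmetric]\<close>)
  also have "\<dots> = (\<integral>\<^sup>+y. ennreal (exp (Suc k * \<epsilon>)) * ennreal (exp (l * heat t F (x + y))) \<partial>isotropic_normal s)"
    by (simp add: ennreal_mult'[symmetric] mult_exp_exp add.commute)
  also have "\<dots> = ennreal (exp (Suc k * \<epsilon>)) * (\<integral>\<^sup>+y. ennreal (exp (l * heat t F (x + y))) \<partial>isotropic_normal s)"
    by (rule nn_integral_cmult) measurable
  also have "\<dots> \<le> ennreal (exp (Suc k * \<epsilon>)) * ennreal (exp (l * heat s (heat t F) x + \<epsilon>))"
    by (rule mult_left_mono[OF step[OF smooth_contraction_heat[OF F t]]]) simp
  also have "\<dots> = ennreal (exp (l * heat (sqrt (Suc (Suc k)) * s) F x + Suc (Suc k) * \<epsilon>))"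
    by (simp add: heat_heat[OF F s t] st ennreal_mult'[symmetric] mult_exp_exp algebra_simps del: of_nat_Suc)
      (simp add: algebra_simps)
  finally show ?case .
qed

text \<open>The constant \<open>C\<close> enters only through \<open>K\<close>, which disappears in
  the limit of infinitely many steps. The bound is therefore independent of \<open>C\<close>, so it
  can be used with the smoothness constant \<open>3 / e\<close> while \<open>e\<close> tends to
  0.\<close>

lemma gaussian_exp_moment:
  fixes F :: "real ^ 'n \<Rightarrow> real"
  assumes F: "smooth_contraction C F v" and "C \<ge> 0" "l \<ge> 0"
  shows "(\<integral>\<^sup>+g. ennreal (exp (l * F g)) \<partial>isotropic_normal 1)
    \<le> ennreal (exp (l * (\<integral>g. F g \<partial>isotropic_normal 1) + l\<^sup>2 / 2))"
proof -
  let ?I = "(\<integral>\<^sup>+g. ennreal (exp (l * F g)) \<partial>isotropic_normal 1)"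
  let ?m = "(\<integral>g. F g \<partial>isotropic_normal 1)"
  obtain K where K: "K \<ge> 0"
    "\<And>(F :: real ^ 'n \<Rightarrow> real) v x s. smooth_contraction C F v \<Longrightarrow> 0 < s \<Longrightarrow> s \<le> 1 \<Longrightarrow>
      (\<integral>\<^sup>+h. ennreal (exp (l * F (x + h))) \<partial>isotropic_normal s)
        \<le> ennreal (exp (l * heat s F x + l\<^sup>2 * s\<^sup>2 / 2 + K * s ^ 3))"
    using exp_moment_small_time[OF assms(2,3)] by blast
  have bd: "?I \<le> ennreal (exp (l * ?m + (l\<^sup>2 / 2 + K / sqrt (Suc k))))" for k :: nat
  proof -
    \<comment> \<open>With this choice \<open>Suc k\<close> steps compose to standard deviation
      1.\<close>
    define s where "s = 1 / sqrt (Suc k)"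
    have s: "0 < s" "s \<le> 1" and ks: "sqrt (Suc k) * s = 1" by (simp_all add: s_def)
    have s2: "Suc k * s\<^sup>2 = 1" by (simp add: s_def power_divide del: of_nat_Suc)
    have "Suc k * (l\<^sup>2 * s\<^sup>2 / 2 + K * s ^ 3) = (Suc k * s\<^sup>2) * (l\<^sup>2 / 2 + K * s)"
      by (simp add: power2_eq_square power3_eq_cube algebra_simps)
    also have "\<dots> = l\<^sup>2 / 2 + K / sqrt (Suc k)"
      by (simp only: s2) (simp add: s_def)
    finally have e: "Suc k * (l\<^sup>2 * s\<^sup>2 / 2 + K * s ^ 3) = l\<^sup>2 / 2 + K / sqrt (Suc k)" .
    have "(\<integral>\<^sup>+h. ennreal (exp (l * F (0 + h))) \<partial>isotropic_normal (sqrt (Suc k) * s))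
        \<le> ennreal (exp (l * heat (sqrt (Suc k) * s) F 0 + Suc k * (l\<^sup>2 * s\<^sup>2 / 2 + K * s ^ 3)))"
    proof (rule exp_moment_iterate[OF s(1) _ F])
      fix F :: "real ^ 'n \<Rightarrow> real" and v x
      assume "smooth_contraction C F v"
      from K(2)[OF this s] show "(\<integral>\<^sup>+h. ennreal (exp (l * F (x + h))) \<partial>isotropic_normal s)
          \<le> ennreal (exp (l * heat s F x + (l\<^sup>2 * s\<^sup>2 / 2 + K * s ^ 3)))"
        by (simp add: add.assoc)
    qed
    then show ?thesis
      unfolding e ks by (simp add: heat_def)
  qed
  have "(\<lambda>k. K / sqrt (real (Suc k))) \<longlonglongrightarrow> 0"
    by (intro real_tendsto_divide_at_top[OF tendsto_const] filterlim_compose[OF sqrt_at_top]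
        filterlim_compose[OF filterlim_real_sequentially filterlim_Suc])
  then have "(\<lambda>k. ennreal (exp (l * ?m + (l\<^sup>2 / 2 + K / sqrt (Suc k)))))
      \<longlonglongrightarrow> ennreal (exp (l * ?m + (l\<^sup>2 / 2 + 0)))"
    by (intro tendsto_ennrealI tendsto_exp tendsto_add tendsto_const)
  then have "?I \<le> ennreal (exp (l * ?m + (l\<^sup>2 / 2 + 0)))"
    by (rule LIMSEQ_le_const) (use bd in blast)
  then show ?thesis by simp
qed

subsection \<open>Projections onto closed convex cones\<close>

text \<open>The projection is tested against two points of its own ray, 0 and its double; the
  variational inequality then holds with both signs.\<close>

lemma closest_point_cone_orthogonal:
  fixes L :: "'a::euclidean_space set"
  assumes L: "closed L" "convex L" "cone L" "L \<noteq> {}"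
  shows "(x - closest_point L x) \<bullet> closest_point L x = 0"
proof -
  let ?p = "closest_point L x"
  have p: "?p \<in> L" using L by (intro closest_point_in_set)
  have dot: "(x - ?p) \<bullet> (w - ?p) \<le> 0" if "w \<in> L" for w
    using closest_point_dot[OF L(2,1) that] .
  have "(x - ?p) \<bullet> (2 *\<^sub>R ?p - ?p) \<le> 0" "(x - ?p) \<bullet> (0 *\<^sub>R ?p - ?p) \<le> 0"
    by (rule dot; rule mem_cone[OF L(3) p]; simp)+
  then show ?thesis
    by (simp add: scaleR_2)
qed

text \<open>Used to reduce noise of level \<open>\<sigma>\<close> to standard noise. Competitors for
  the scaled problem are divided by \<open>c\<close>, which keeps them in the cone.\<close>

lemma closest_point_cone_scaleR:
  fixes L :: "'a::euclidean_space set"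
  assumes L: "closed L" "convex L" "cone L" "L \<noteq> {}" and "c > 0"
  shows "closest_point L (c *\<^sub>R x) = c *\<^sub>R closest_point L x"
proof (rule sym, rule closest_point_unique[OF L(2,1)])
  show "c *\<^sub>R closest_point L x \<in> L"
    using L closest_point_in_set[of L x] \<open>c > 0\<close> by (intro mem_cone) auto
  show "\<forall>z\<in>L. dist (c *\<^sub>R x) (c *\<^sub>R closest_point L x) \<le> dist (c *\<^sub>R x) z"
  proof
    fix z assume "z \<in> L"
    then have "(1 / c) *\<^sub>R z \<in> L"
      using L(3) \<open>c > 0\<close> by (intro mem_cone) auto
    from closest_point_le[OF L(1) this, of x]
    have "c * dist x (closest_point L x) \<le> c * dist x ((1 / c) *\<^sub>R z)"
      using \<open>c > 0\<close> by simp
    also have "\<dots> = dist (c *\<^sub>R x) (c *\<^sub>R ((1 / c) *\<^sub>R z))"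
      using \<open>c > 0\<close> by (simp only: dist_norm scaleR_diff_right[symmetric] norm_scaleR abs_of_pos)
    finally show "dist (c *\<^sub>R x) (c *\<^sub>R closest_point L x) \<le> dist (c *\<^sub>R x) z"
      using \<open>c > 0\<close> by (simp add: dist_norm scaleR_diff_right[symmetric])
  qed
qed

lemma norm_closest_point_cone:
  fixes L :: "'a::euclidean_space set"
  assumes L: "closed L" "convex L" "cone L" "L \<noteq> {}"
  shows "(norm (closest_point L x))\<^sup>2 = (norm x)\<^sup>2 - (dist x (closest_point L x))\<^sup>2"
proof -
  let ?p = "closest_point L x"
  have "(norm x)\<^sup>2 = (norm ((x - ?p) + ?p))\<^sup>2" by simp
  also have "\<dots> = (dist x ?p)\<^sup>2 + (norm ?p)\<^sup>2"
    using closest_point_cone_orthogonal[OF L, of x]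
    by (simp only: power2_norm_eq_inner dist_norm inner_add_left inner_add_right) (simp add: inner_commute)
  finally show ?thesis by simp
qed

text \<open>By Pythagoras this is the minimality of the distance from \<open>x\<close>. It bounds
  the squared norm of the projection below by functions affine in \<open>x\<close>, with equality
  when \<open>w\<close> is the projection itself.\<close>

lemma norm_closest_point_cone_lower:
  fixes L :: "'a::euclidean_space set"
  assumes L: "closed L" "convex L" "cone L" "L \<noteq> {}" and "w \<in> L"
  shows "2 * (x \<bullet> w) - (norm w)\<^sup>2 \<le> (norm (closest_point L x))\<^sup>2"
proof -
  have "(dist x (closest_point L x))\<^sup>2 \<le> (dist x w)\<^sup>2"
    using closest_point_le[OF L(1) \<open>w \<in> L\<close>] by (intro power_mono) auto
  also have "\<dots> = (norm x)\<^sup>2 - 2 * (x \<bullet> w) + (norm w)\<^sup>2"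
    by (simp add: dist_norm power2_norm_eq_inner inner_diff_left inner_diff_right inner_commute)
  finally show ?thesis
    by (simp add: norm_closest_point_cone[OF L])
qed

text \<open>The squared norm of the projection is convex with gradient
  \<open>2 *\<^sub>R p x\<close>. The lower bound takes \<open>p x\<close> as competitor at
  \<open>x + h\<close>; the upper bound takes \<open>p (x + h)\<close> as competitor at
  \<open>x\<close> and then uses that \<open>p\<close> is 1-Lipschitz.\<close>

lemma norm_closest_point_cone_quadratic:
  fixes L :: "'a::euclidean_space set"
  assumes L: "closed L" "convex L" "cone L" "L \<noteq> {}"
  defines "p \<equiv> closest_point L"
  shows "0 \<le> (norm (p (x + h)))\<^sup>2 - (norm (p x))\<^sup>2 - 2 * (p x \<bullet> h)"
    and "(norm (p (x + h)))\<^sup>2 - (norm (p x))\<^sup>2 - 2 * (p x \<bullet> h) \<le> 2 * (norm h)\<^sup>2"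
proof -
  have pin: "p z \<in> L" for z unfolding p_def using L by (intro closest_point_in_set)
  have pp: "(norm (p z))\<^sup>2 = z \<bullet> p z" for z
    using closest_point_cone_orthogonal[OF L, of z] by (simp add: p_def inner_diff_left power2_norm_eq_inner)
  have "2 * ((x + h) \<bullet> p x) - (norm (p x))\<^sup>2 \<le> (norm (p (x + h)))\<^sup>2"
    unfolding p_def by (rule norm_closest_point_cone_lower[OF L pin[unfolded p_def]])
  then show "0 \<le> (norm (p (x + h)))\<^sup>2 - (norm (p x))\<^sup>2 - 2 * (p x \<bullet> h)"
    by (simp add: pp inner_add_left inner_add_right inner_commute)
  have "2 * (x \<bullet> p (x + h)) - (norm (p (x + h)))\<^sup>2 \<le> (norm (p x))\<^sup>2"
    unfolding p_def by (rule norm_closest_point_cone_lower[OF L pin[unfolded p_def]])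
  then have "(norm (p (x + h)))\<^sup>2 - (norm (p x))\<^sup>2 \<le> 2 * (p (x + h) \<bullet> h)"
    by (simp add: pp inner_add_left inner_add_right inner_commute)
  also have "p (x + h) \<bullet> h = p x \<bullet> h + (p (x + h) - p x) \<bullet> h"
    by (simp add: inner_diff_left)
  also have "(p (x + h) - p x) \<bullet> h \<le> norm (p (x + h) - p x) * norm h"
    by (rule norm_cauchy_schwarz)
  also have "\<dots> \<le> norm h * norm h"
    using closest_point_lipschitz[OF L(2,1,4), of "x + h" x]
    by (intro mult_right_mono) (auto simp: p_def dist_norm)
  finally show "(norm (p (x + h)))\<^sup>2 - (norm (p x))\<^sup>2 - 2 * (p x \<bullet> h) \<le> 2 * (norm h)\<^sup>2"
    by (simp add: power2_eq_square)
qed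

text \<open>Each root is the norm of a pair in the plane, so this is the reverse triangle
  inequality.\<close>

lemma sqrt_add_square_lipschitz:
  fixes a b e :: real
  shows "\<bar>sqrt (e\<^sup>2 + a\<^sup>2) - sqrt (e\<^sup>2 + b\<^sup>2)\<bar> \<le> \<bar>a - b\<bar>"
proof -
  have "\<bar>norm (e, a) - norm (e, b)\<bar> \<le> norm ((e, a) - (e, b))" by (rule norm_triangle_ineq3)
  then show ?thesis by (simp add: norm_Pair)
qed

text \<open>
  The norm of the projection is not smooth where the projection vanishes, hence the
  regularisation by \<open>e\<close>.
\<close>

lemma smooth_contraction_closest_point_cone:
  fixes L :: "(real ^ 'n) set"
  assumes L: "closed L" "convex L" "cone L" "L \<noteq> {}" and e: "e > 0"
  defines "p \<equiv> closest_point L"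
  defines "F \<equiv> \<lambda>x. sqrt (e\<^sup>2 + (norm (p x))\<^sup>2)"
  shows "smooth_contraction (3 / e) F (\<lambda>x. (1 / F x) *\<^sub>R p x)"
proof -
  have lip_p: "norm (p x - p y) \<le> norm (x - y)" for x y
    using closest_point_lipschitz[OF L(2,1,4), of x y] by (simp add: p_def dist_norm)
  have cont_p: "continuous_on UNIV p"
    unfolding p_def by (rule continuous_on_closest_point[OF L(2,1,4)])
  have F_sq: "(F x)\<^sup>2 = e\<^sup>2 + (norm (p x))\<^sup>2" for x
    by (simp add: F_def)
  have Fe: "F x \<ge> e" for x
    unfolding F_def by (rule real_le_rsqrt) simp
  then have Fpos: "F x > 0" for x using e by (meson less_le_trans)
  have Fp: "norm (p x) \<le> F x" for x
    unfolding F_def by (rule real_le_rsqrt) simp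
  have lip: "\<bar>F x - F y\<bar> \<le> norm (x - y)" for x y
  proof -
    have "\<bar>F x - F y\<bar> \<le> \<bar>norm (p x) - norm (p y)\<bar>"
      unfolding F_def by (rule sqrt_add_square_lipschitz)
    also have "\<dots> \<le> norm (p x - p y)" by (rule norm_triangle_ineq3)
    finally show ?thesis using lip_p[of x y] by simp
  qed
  have quad: "\<bar>F (x + h) - F x - ((1 / F x) *\<^sub>R p x) \<bullet> h\<bar> \<le> 3 / e * (norm h)\<^sup>2" for x h
  proof -
    define q where "q = (norm (p (x + h)))\<^sup>2 - (norm (p x))\<^sup>2 - 2 * (p x \<bullet> h)"
    have q: "0 \<le> q" "q \<le> 2 * (norm h)\<^sup>2"
      unfolding q_def p_def by (rule norm_closest_point_cone_quadratic[OF L])+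
    \<comment> \<open>Multiplying by \<open>S\<close> turns the difference of square roots into a
      difference of squares, which the quadratic bounds control; dividing back costs at most
      \<open>1 / e\<close>.\<close>
    define S where "S = F (x + h) + F x"
    have S: "S \<ge> e" using Fe[of "x + h"] Fpos[of x] by (simp add: S_def)
    have "(F (x + h) - F x) * S = 2 * (p x \<bullet> h) + q"
    proof -
      have "(F (x + h) - F x) * S = (F (x + h))\<^sup>2 - (F x)\<^sup>2"
        unfolding S_def by (simp add: power2_eq_square algebra_simps)
      then show ?thesis by (simp add: F_sq q_def)
    qed
    \<comment> \<open>This corrects for \<open>S\<close> not being exactly \<open>2 * F x\<close>.
      The constant 3 is 2 from \<open>q\<close> plus 1 from \<open>w\<close>.\<close>
    define w where "w = (p x \<bullet> h) / F x * (F x - F (x + h))"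
    have "(F (x + h) - F x - (p x \<bullet> h) / F x) * S = q + w"
      using \<open>(F (x + h) - F x) * S = 2 * (p x \<bullet> h) + q\<close> Fpos[of x]
      by (simp add: S_def w_def field_simps)
    moreover have "\<bar>w\<bar> \<le> (norm h)\<^sup>2"
    proof -
      have "\<bar>p x \<bullet> h\<bar> \<le> F x * norm h"
        by (rule order_trans[OF Cauchy_Schwarz_ineq2]) (intro mult_right_mono Fp norm_ge_zero)
      then have "\<bar>(p x \<bullet> h) / F x\<bar> \<le> norm h"
        using Fpos[of x] by (simp add: abs_divide divide_le_eq mult.commute)
      moreover have "\<bar>F x - F (x + h)\<bar> \<le> norm h"
        using lip[of x "x + h"] by simp
      ultimately show ?thesis
        unfolding w_def abs_mult power2_eq_square by (intro mult_mono) auto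
    qed
    ultimately have "\<bar>(F (x + h) - F x - (p x \<bullet> h) / F x) * S\<bar> \<le> 3 * (norm h)\<^sup>2"
      using q abs_triangle_ineq[of q w] by simp
    moreover have "\<bar>F (x + h) - F x - (p x \<bullet> h) / F x\<bar> * e \<le>
        \<bar>F (x + h) - F x - (p x \<bullet> h) / F x\<bar> * \<bar>S\<bar>"
      using S e by (intro mult_left_mono) auto
    ultimately have "\<bar>F (x + h) - F x - (p x \<bullet> h) / F x\<bar> * e \<le> 3 * (norm h)\<^sup>2"
      unfolding abs_mult by (rule order_trans[rotated])
    then show ?thesis
      using e by (simp add: pos_le_divide_eq)
  qed
  show ?thesis
    unfolding smooth_contraction_def
  proof (intro conjI allI lip quad)
    have [measurable]: "p \<in> borel_measurable borel"
      by (rule borel_measurable_continuous_onI[OF cont_p])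
    show "(\<lambda>x. (1 / F x) *\<^sub>R p x) \<in> borel_measurable borel"
      unfolding F_def by measurable
    show "norm ((1 / F x) *\<^sub>R p x) \<le> 1" for x
      using Fp[of x] Fpos[of x] by (simp add: divide_le_eq)
  qed
qed

lemma integrable_norm_closest_point_cone:
  fixes L :: "(real ^ 'n) set"
  assumes L: "closed L" "convex L" "cone L" "L \<noteq> {}" and "s > 0"
  shows "integrable (isotropic_normal s) (\<lambda>g. (norm (closest_point L g))\<^sup>2)"
proof (rule integrable_isotropic_normal_exp_bound[OF \<open>s > 0\<close>, where K=2 and c=1])
  have [measurable]: "closest_point L \<in> borel_measurable borel"
    by (rule borel_measurable_continuous_onI[OF continuous_on_closest_point[OF L(2,1,4)]])
  show "(\<lambda>g. (norm (closest_point L g))\<^sup>2) \<in> borel_measurable borel" by measurable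
  fix g :: "real ^ 'n"
  have "(norm (closest_point L g))\<^sup>2 \<le> (norm g)\<^sup>2"
    by (simp add: norm_closest_point_cone[OF L])
  also have "\<dots> \<le> 2 * exp (norm g)"
    by (simp add: square_le_two_exp)
  finally show "norm ((norm (closest_point L g))\<^sup>2) \<le> 2 * exp (1 * norm g)"
    by simp
qed

section \<open>Concentration of the norm of the projection\<close>

lemma statistical_dimension_eq:
  "statistical_dimension L = (\<integral>g. (norm (closest_point L g))\<^sup>2 \<partial>isotropic_normal 1)"
  by (simp add: statistical_dimension_def isotropic_normal_def)

lemma statistical_dimension_nonneg: "0 \<le> statistical_dimension L"
  by (simp add: statistical_dimension_def)

text \<open>A Chernoff bound for the regularised norm, with the exponent \<open>l = t\<close> that
  minimises \<open>l\<^sup>2 / 2 - l * t\<close>. The event does not involve \<open>e\<close>, so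
  the bounds for positive \<open>e\<close> pass to the limit.\<close>

lemma norm_closest_point_cone_concentration:
  fixes L :: "(real ^ 'n) set"
  assumes L: "closed L" "convex L" "cone L" "L \<noteq> {}" and "t \<ge> 0"
  shows "measure (isotropic_normal 1) {g. sqrt (statistical_dimension L) + t \<le> norm (closest_point L g)}
    \<le> exp (- t\<^sup>2 / 2)"
proof -
  let ?\<gamma> = "isotropic_normal 1 :: (real ^ 'n) measure"
  let ?p = "closest_point L"
  let ?\<delta> = "statistical_dimension L"
  let ?A = "{g. sqrt ?\<delta> + t \<le> norm (?p g)}"
  interpret prob_space ?\<gamma> by (rule prob_space_isotropic_normal) simp
  have [measurable]: "?p \<in> borel_measurable borel"
    by (rule borel_measurable_continuous_onI[OF continuous_on_closest_point[OF L(2,1,4)]])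
  have bd: "emeasure ?\<gamma> ?A \<le> ennreal (exp (t * (sqrt (e\<^sup>2 + ?\<delta>) - sqrt ?\<delta>) - t\<^sup>2 / 2))"
    if e: "e > 0" for e
  proof -
    define F where "F x = sqrt (e\<^sup>2 + (norm (?p x))\<^sup>2)" for x
    have F: "smooth_contraction (3 / e) F (\<lambda>x. (1 / F x) *\<^sub>R ?p x)"
      unfolding F_def[abs_def] by (rule smooth_contraction_closest_point_cone[OF L e])
    note [measurable] = smooth_contraction_borel_measurable[OF F]
    have F_sq: "(F x)\<^sup>2 = e\<^sup>2 + (norm (?p x))\<^sup>2" for x
      by (simp add: F_def)
    have intF: "integrable ?\<gamma> F"
      using smooth_contraction_integrable(1)[OF F, of 1 0] by simp
    have intF2: "integrable ?\<gamma> (\<lambda>x. (F x)\<^sup>2)"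
      unfolding F_sq using integrable_norm_closest_point_cone[OF L, of 1] by simp
    \<comment> \<open>Jensen's inequality for the square, in the form that a variance is
      nonnegative.\<close>
    have "(expectation F)\<^sup>2 \<le> e\<^sup>2 + ?\<delta>"
    proof -
      have "0 \<le> variance F" by simp
      also have "\<dots> = expectation (\<lambda>x. (F x)\<^sup>2) - (expectation F)\<^sup>2"
        by (rule variance_eq[OF intF intF2])
      also have "expectation (\<lambda>x. (F x)\<^sup>2) = e\<^sup>2 + ?\<delta>"
        unfolding F_sq statistical_dimension_eq
        using integrable_norm_closest_point_cone[OF L, of 1] by (simp add: prob_space[simplified])
      finally show ?thesis by simp
    qed
    then have EF: "expectation F \<le> sqrt (e\<^sup>2 + ?\<delta>)"
      by (rule real_le_rsqrt)
    have "emeasure ?\<gamma> ?A = (\<integral>\<^sup>+g. indicator ?A g \<partial>?\<gamma>)"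
      by (rule nn_integral_indicator[symmetric]) simp
    also have "\<dots> \<le> (\<integral>\<^sup>+g. ennreal (exp (- t * (sqrt ?\<delta> + t))) * ennreal (exp (t * F g)) \<partial>?\<gamma>)"
    proof (rule nn_integral_mono)
      fix g
      show "indicator ?A g \<le> ennreal (exp (- t * (sqrt ?\<delta> + t))) * ennreal (exp (t * F g))"
      proof (cases "g \<in> ?A")
        case True
        moreover have "norm (?p g) \<le> F g"
          unfolding F_def by (rule real_le_rsqrt) simp
        ultimately have "t * (sqrt ?\<delta> + t) \<le> t * F g"
          using \<open>t \<ge> 0\<close> by (intro mult_left_mono) auto
        then have "1 \<le> exp (- t * (sqrt ?\<delta> + t)) * exp (t * F g)"
          by (simp add: mult_exp_exp)
        then show ?thesis
          using True by (simp add: ennreal_mult'[symmetric] ennreal_1[symmetric] del: ennreal_1)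
      qed simp
    qed
    also have "\<dots> = ennreal (exp (- t * (sqrt ?\<delta> + t))) * (\<integral>\<^sup>+g. ennreal (exp (t * F g)) \<partial>?\<gamma>)"
      by (rule nn_integral_cmult) measurable
    also have "\<dots> \<le> ennreal (exp (- t * (sqrt ?\<delta> + t))) * ennreal (exp (t * expectation F + t\<^sup>2 / 2))"
      using e \<open>t \<ge> 0\<close> by (intro mult_left_mono gaussian_exp_moment[OF F]) auto
    also have "\<dots> = ennreal (exp (t * expectation F - t * sqrt ?\<delta> - t\<^sup>2 / 2))"
      by (simp add: ennreal_mult'[symmetric] mult_exp_exp power2_eq_square algebra_simps)
    also have "\<dots> \<le> ennreal (exp (t * (sqrt (e\<^sup>2 + ?\<delta>) - sqrt ?\<delta>) - t\<^sup>2 / 2))"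
      using mult_left_mono[OF EF \<open>t \<ge> 0\<close>] by (auto simp: algebra_simps intro!: ennreal_leI)
    finally show ?thesis .
  qed
  have "(\<lambda>k. inverse (real (Suc k))) \<longlonglongrightarrow> 0"
    by (rule LIMSEQ_inverse_real_of_nat)
  then have "(\<lambda>k. ennreal (exp (t * (sqrt ((inverse (real (Suc k)))\<^sup>2 + ?\<delta>) - sqrt ?\<delta>) - t\<^sup>2 / 2)))
      \<longlonglongrightarrow> ennreal (exp (t * (sqrt (0\<^sup>2 + ?\<delta>) - sqrt ?\<delta>) - t\<^sup>2 / 2))"
    by (intro tendsto_ennrealI tendsto_intros)
  then have "emeasure ?\<gamma> ?A \<le> ennreal (exp (t * (sqrt (0\<^sup>2 + ?\<delta>) - sqrt ?\<delta>) - t\<^sup>2 / 2))"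
    by (rule LIMSEQ_le_const) (use bd in auto)
  then show ?thesis
    by (simp add: emeasure_eq_measure)
qed

subsection \<open>Least squares over a convex set\<close>

lemma tangent_cone_eq_closure_cone_hull:
  "tangent_cone K u = closure (cone hull ((\<lambda>v. v - u) ` K))"
  unfolding tangent_cone_def cone_hull_expl by (rule arg_cong[where f=closure]) auto

lemma diff_in_tangent_cone:
  assumes "v \<in> K"
  shows "v - u \<in> tangent_cone K u"
  unfolding tangent_cone_eq_closure_cone_hull
  by (rule subsetD[OF closure_subset]) (use assms in \<open>auto intro: hull_inc\<close>)

lemma tangent_cone_closed_convex_cone:
  assumes "convex K" "u \<in> K"
  shows "closed (tangent_cone K u)" "convex (tangent_cone K u)" "cone (tangent_cone K u)"
    "tangent_cone K u \<noteq> {}"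
proof -
  have "convex ((\<lambda>v. v - u) ` K)"
    using convex_translation[OF assms(1), of "- u"] by simp
  then show "closed (tangent_cone K u)" "convex (tangent_cone K u)" "cone (tangent_cone K u)"
    unfolding tangent_cone_eq_closure_cone_hull
    by (auto intro!: convex_closure convex_cone_hull cone_closure cone_cone_hull)
  show "tangent_cone K u \<noteq> {}"
    using diff_in_tangent_cone[OF assms(2)] by blast
qed

lemma scaled_norm_square: "(scaled_norm v)\<^sup>2 = (norm (v :: real ^ 'n))\<^sup>2 / real CARD('n)"
  by (simp add: scaled_norm_def sum_nonneg norm_vec_square)

text \<open>The two norms differ by a constant factor and so have the same minimisers. This makes
  the estimator a function of the data alone, from which measurability of the loss is
  obtained.\<close>

lemma is_least_squares_closest_point:
  assumes "closed K" "convex K" "is_least_squares K y m"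
  shows "m = closest_point K y"
proof -
  have m: "m \<in> K" "\<And>z. z \<in> K \<Longrightarrow> (scaled_norm (y - m))\<^sup>2 \<le> (scaled_norm (y - z))\<^sup>2"
    using assms(3) by (auto simp: is_least_squares_def is_arg_min_linorder)
  show ?thesis
  proof (rule closest_point_unique[OF assms(2,1) m(1)], rule ballI)
    fix z assume "z \<in> K"
    then have "(norm (y - m))\<^sup>2 \<le> (norm (y - z))\<^sup>2"
      using m(2)[of z] by (simp add: scaled_norm_square divide_le_cancel)
    then show "dist y m \<le> dist y z"
      by (simp add: dist_norm)
  qed
qed

lemma closest_point_excess_risk:
  fixes K :: "(real ^ 'n) set"
  assumes "closed K" "convex K" "u \<in> K"
  shows "(norm (closest_point K (m + w) - m))\<^sup>2 - (norm (u - m))\<^sup>2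
    \<le> (norm (closest_point (tangent_cone K u) w))\<^sup>2"
proof -
  let ?p = "closest_point K (m + w)"
  define d where "d = ?p - u"
  have p: "?p \<in> K" using assms by (intro closest_point_in_set) auto
  \<comment> \<open>Testing the projection at \<open>u\<close> is what matters: twice the resulting
    inequality cancels the cross term \<open>2 * ((u - m) \<bullet> d)\<close> of the expansion
    below and turns \<open>(norm d)\<^sup>2\<close> into its negative.\<close>
  have "(m + w - ?p) \<bullet> (u - ?p) \<le> 0"
    using assms by (intro closest_point_dot)
  then have "(norm d)\<^sup>2 \<le> (m + w - u) \<bullet> d"
    by (simp add: d_def power2_norm_eq_inner inner_diff_left inner_diff_right inner_add_left inner_commute)
  moreover have "(norm (?p - m))\<^sup>2 - (norm (u - m))\<^sup>2 = (norm d)\<^sup>2 + 2 * ((u - m) \<bullet> d)"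
    by (simp add: d_def power2_norm_eq_inner inner_diff_left inner_diff_right inner_commute)
  ultimately have "(norm (?p - m))\<^sup>2 - (norm (u - m))\<^sup>2 \<le> 2 * (w \<bullet> d) - (norm d)\<^sup>2"
    by (simp add: inner_diff_left inner_add_left)
  also have "\<dots> \<le> (norm (closest_point (tangent_cone K u) w))\<^sup>2"
    unfolding d_def
    by (intro norm_closest_point_cone_lower tangent_cone_closed_convex_cone[OF assms(2,3)]
        diff_in_tangent_cone p)
  finally show ?thesis .
qed

theorem corollary2p2:
  fixes M :: "'a measure"
    and \<mu> u :: "real ^ 'n"
    and K :: "(real ^ 'n) set"
    and \<sigma> :: real
    and \<xi> y \<mu>hat :: "'a \<Rightarrow> real ^ 'n"
  assumes "prob_space M"
    and "closed K" and "convex K" and "u \<in> K"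
    and "\<sigma> > 0"
    and "distributed M lborel \<xi> (\<lambda>x. ennreal (isotropic_normal_density \<sigma> x))"
    and "y = (\<lambda>\<omega>. \<mu> + \<xi> \<omega>)"
    and "\<And>\<omega>. \<omega> \<in> space M \<Longrightarrow> is_least_squares K (y \<omega>) (\<mu>hat \<omega>)"
  shows "integrable M (\<lambda>\<omega>. (scaled_norm (\<mu>hat \<omega> - \<mu>))\<^sup>2)
    \<and> (\<integral>\<omega>. (scaled_norm (\<mu>hat \<omega> - \<mu>))\<^sup>2 \<partial>M)
        \<le> (scaled_norm (u - \<mu>))\<^sup>2
          + \<sigma>\<^sup>2 / real CARD('n) * statistical_dimension (tangent_cone K u)
    \<and> (\<forall>x>0. measure M {\<omega> \<in> space M.
            (scaled_norm (\<mu>hat \<omega> - \<mu>))\<^sup>2 - (scaled_norm (u - \<mu>))\<^sup>2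
              \<le> \<sigma>\<^sup>2 / real CARD('n) * (sqrt (statistical_dimension (tangent_cone K u)) + sqrt (2 * x))\<^sup>2
          \<and> \<sigma>\<^sup>2 / real CARD('n) * (sqrt (statistical_dimension (tangent_cone K u)) + sqrt (2 * x))\<^sup>2
              \<le> \<sigma>\<^sup>2 / real CARD('n) * (2 * statistical_dimension (tangent_cone K u) + 4 * x)}
          \<ge> 1 - exp (- x))"
proof -
  interpret prob_space M by fact
  let ?\<gamma> = "isotropic_normal 1 :: (real ^ 'n) measure"
  define T where "T = tangent_cone K u"
  note T = tangent_cone_closed_convex_cone[OF assms(3,4), folded T_def]
  define \<delta> where "\<delta> = statistical_dimension T"
  define X where "X \<omega> = norm (closest_point T ((1 / \<sigma>) *\<^sub>R \<xi> \<omega>))" for \<omega>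
  have \<delta>: "\<delta> \<ge> 0" by (simp add: \<delta>_def statistical_dimension_nonneg)
  have [measurable]: "closest_point T \<in> borel_measurable borel"
    by (rule borel_measurable_continuous_onI[OF continuous_on_closest_point[OF T(2,1,4)]])
  have [measurable]: "closest_point K \<in> borel_measurable borel"
    using assms(2-4) by (intro borel_measurable_continuous_onI continuous_on_closest_point) auto
  have \<xi>[measurable]: "\<xi> \<in> borel_measurable M"
    using distributed_measurable[OF assms(6)] by simp
  have std: "distr M borel (\<lambda>\<omega>. (1 / \<sigma>) *\<^sub>R \<xi> \<omega>) = ?\<gamma>"
  proof -
    have "distr M borel \<xi> = isotropic_normal \<sigma>"
      using distributed_distr_eq_density[OF assms(6)]
      by (simp add: isotropic_normal_def cong: distr_cong)
    then have "distr (distr M borel \<xi>) borel (\<lambda>x. (1 / \<sigma>) *\<^sub>R x) = ?\<gamma>"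
      using assms(5) by (simp add: distr_isotropic_normal_scaleR)
    then show ?thesis by (simp add: distr_distr o_def)
  qed
  have [measurable]: "X \<in> borel_measurable M" unfolding X_def[abs_def] by measurable
  have X2: "integrable M (\<lambda>\<omega>. (X \<omega>)\<^sup>2)" "expectation (\<lambda>\<omega>. (X \<omega>)\<^sup>2) = \<delta>"
  proof -
    have "integrable (distr M borel (\<lambda>\<omega>. (1 / \<sigma>) *\<^sub>R \<xi> \<omega>)) (\<lambda>g. (norm (closest_point T g))\<^sup>2)"
      unfolding std using integrable_norm_closest_point_cone[OF T] by simp
    then show "integrable M (\<lambda>\<omega>. (X \<omega>)\<^sup>2)"
      unfolding X_def by (subst (asm) integrable_distr_eq) auto
    have "\<delta> = (\<integral>g. (norm (closest_point T g))\<^sup>2 \<partial>distr M borel (\<lambda>\<omega>. (1 / \<sigma>) *\<^sub>R \<xi> \<omega>))"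
      by (simp only: std \<delta>_def statistical_dimension_eq)
    also have "\<dots> = expectation (\<lambda>\<omega>. (X \<omega>)\<^sup>2)"
      unfolding X_def by (subst integral_distr) auto
    finally show "expectation (\<lambda>\<omega>. (X \<omega>)\<^sup>2) = \<delta>" ..
  qed
  \<comment> \<open>The loss written through the projection, which is measurable; it agrees with the
    loss of \<open>\<mu>hat\<close> on \<open>space M\<close>, where \<open>\<mu>hat\<close> is
    constrained.\<close>
  define R where "R \<omega> = (scaled_norm (closest_point K (\<mu> + \<xi> \<omega>) - \<mu>))\<^sup>2" for \<omega>
  have hat: "(scaled_norm (\<mu>hat \<omega> - \<mu>))\<^sup>2 = R \<omega>" if "\<omega> \<in> space M" for \<omega>
    using is_least_squares_closest_point[OF assms(2,3) assms(8)[OF that]] assms(7) by (simp add: R_def)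
  have [measurable]: "R \<in> borel_measurable M"
    unfolding R_def[abs_def] scaled_norm_square by measurable
  have R: "R \<omega> - (scaled_norm (u - \<mu>))\<^sup>2 \<le> \<sigma>\<^sup>2 / real CARD('n) * (X \<omega>)\<^sup>2" for \<omega>
  proof -
    have "closest_point T (\<xi> \<omega>) = \<sigma> *\<^sub>R closest_point T ((1 / \<sigma>) *\<^sub>R \<xi> \<omega>)"
      using closest_point_cone_scaleR[OF T assms(5), of "(1 / \<sigma>) *\<^sub>R \<xi> \<omega>"] assms(5) by simp
    then have "(norm (closest_point T (\<xi> \<omega>)))\<^sup>2 = \<sigma>\<^sup>2 * (X \<omega>)\<^sup>2"
      using assms(5) by (simp add: X_def power_mult_distrib)
    then have "(norm (closest_point K (\<mu> + \<xi> \<omega>) - \<mu>))\<^sup>2 - (norm (u - \<mu>))\<^sup>2 \<le> \<sigma>\<^sup>2 * (X \<omega>)\<^sup>2"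
      using closest_point_excess_risk[OF assms(2-4), of \<mu> "\<xi> \<omega>"] by (simp add: T_def)
    then show ?thesis
      by (simp add: R_def scaled_norm_square diff_divide_distrib[symmetric] divide_right_mono)
  qed
  let ?B = "\<lambda>\<omega>. (scaled_norm (u - \<mu>))\<^sup>2 + \<sigma>\<^sup>2 / real CARD('n) * (X \<omega>)\<^sup>2"
  have intB: "integrable M ?B" using X2 by simp
  \<comment> \<open>Since \<open>R\<close> is nonnegative, the pathwise upper bound
    \<open>?B\<close> also dominates it in absolute value.\<close>
  have intR: "integrable M R"
  proof (rule Bochner_Integration.integrable_bound[OF intB])
    show "AE \<omega> in M. norm (R \<omega>) \<le> norm (?B \<omega>)"
      using R by (intro AE_I2) (force simp: R_def algebra_simps intro: order_trans[OF _ abs_ge_self])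
  qed simp
  have "expectation R \<le> expectation ?B"
    using intR intB R by (intro integral_mono) (auto simp: algebra_simps)
  also have "\<dots> = (scaled_norm (u - \<mu>))\<^sup>2 + \<sigma>\<^sup>2 / real CARD('n) * \<delta>"
    using X2 by (simp add: prob_space)
  finally have ER: "expectation R \<le> (scaled_norm (u - \<mu>))\<^sup>2 + \<sigma>\<^sup>2 / real CARD('n) * \<delta>" .
  have tail: "1 - exp (- x) \<le> prob {\<omega> \<in> space M.
      (scaled_norm (\<mu>hat \<omega> - \<mu>))\<^sup>2 - (scaled_norm (u - \<mu>))\<^sup>2 \<le> \<sigma>\<^sup>2 / real CARD('n) * (sqrt \<delta> + sqrt (2 * x))\<^sup>2
      \<and> \<sigma>\<^sup>2 / real CARD('n) * (sqrt \<delta> + sqrt (2 * x))\<^sup>2 \<le> \<sigma>\<^sup>2 / real CARD('n) * (2 * \<delta> + 4 * x)}"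
    (is "_ \<le> prob ?E") if x: "x > 0" for x
  proof -
    let ?a = "sqrt \<delta> + sqrt (2 * x)"
    have "?a\<^sup>2 \<le> 2 * (sqrt \<delta>)\<^sup>2 + 2 * (sqrt (2 * x))\<^sup>2"
      using zero_le_power2[of "sqrt \<delta> - sqrt (2 * x)"] by (simp only: power2_sum power2_diff)
    then have a: "\<sigma>\<^sup>2 / real CARD('n) * ?a\<^sup>2 \<le> \<sigma>\<^sup>2 / real CARD('n) * (2 * \<delta> + 4 * x)"
      using \<delta> x by (intro mult_left_mono) auto
    \<comment> \<open>The second inequality in the event is deterministic and holds by
      \<open>a\<close>, so only the first one restricts the event.\<close>
    have E: "?E = {\<omega> \<in> space M. R \<omega> - (scaled_norm (u - \<mu>))\<^sup>2 \<le> \<sigma>\<^sup>2 / real CARD('n) * ?a\<^sup>2}"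
      using hat a by auto
    have "prob {\<omega> \<in> space M. ?a \<le> X \<omega>} = measure (distr M borel (\<lambda>\<omega>. (1 / \<sigma>) *\<^sub>R \<xi> \<omega>))
        {g. ?a \<le> norm (closest_point T g)}"
      by (subst measure_distr) (auto simp: X_def vimage_def Int_def intro!: arg_cong[where f=prob])
    \<comment> \<open>The deviation \<open>t = sqrt (2 * x)\<close> is chosen to make
      \<open>t\<^sup>2 / 2\<close> equal to \<open>x\<close>.\<close>
    also have "\<dots> \<le> exp (- (sqrt (2 * x))\<^sup>2 / 2)"
      unfolding std \<delta>_def using x by (intro norm_closest_point_cone_concentration[OF T]) simp
    also have "\<dots> = exp (- x)" using x by simp
    finally have "1 - exp (- x) \<le> 1 - prob {\<omega> \<in> space M. ?a \<le> X \<omega>}" by simp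
    also have "\<dots> = prob (space M - {\<omega> \<in> space M. ?a \<le> X \<omega>})"
      by (rule prob_compl[symmetric]) simp
    also have "\<dots> \<le> prob ?E"
      unfolding E
    proof (rule finite_measure_mono)
      show "space M - {\<omega> \<in> space M. ?a \<le> X \<omega>} \<subseteq>
          {\<omega> \<in> space M. R \<omega> - (scaled_norm (u - \<mu>))\<^sup>2 \<le> \<sigma>\<^sup>2 / real CARD('n) * ?a\<^sup>2}"
      proof safe
        fix \<omega> assume "\<omega> \<in> space M" "\<not> ?a \<le> X \<omega>"
        then have "(X \<omega>)\<^sup>2 \<le> ?a\<^sup>2" by (intro power_mono) (auto simp: X_def)
        then have "\<sigma>\<^sup>2 / real CARD('n) * (X \<omega>)\<^sup>2 \<le> \<sigma>\<^sup>2 / real CARD('n) * ?a\<^sup>2"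
          by (intro mult_left_mono) auto
        then show "R \<omega> - (scaled_norm (u - \<mu>))\<^sup>2 \<le> \<sigma>\<^sup>2 / real CARD('n) * ?a\<^sup>2"
          using R[of \<omega>] by linarith
      qed
    qed simp
    finally show ?thesis .
  qed
  have "integrable M (\<lambda>\<omega>. (scaled_norm (\<mu>hat \<omega> - \<mu>))\<^sup>2) \<longleftrightarrow> integrable M R"
    by (rule Bochner_Integration.integrable_cong) (auto simp: hat)
  moreover have "(\<integral>\<omega>. (scaled_norm (\<mu>hat \<omega> - \<mu>))\<^sup>2 \<partial>M) = expectation R"
    by (rule Bochner_Integration.integral_cong) (auto simp: hat)
  ultimately show ?thesis
    using intR ER tail by (simp add: \<delta>_def T_def)
qed

end
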